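(* Let $F$ be an $\exists$LIRA transition formula of dimension $n$. Algorithm abstract-VASR (described in the context) terminates on input $F$ and returns a pair $(S,V)$, with $S \in \mathbb{Q}^{d\times n}$ and $V$ a $d$-dimensional $\mathbb{Q}$-VASR, such that $F \Vdash_S V$ (i.e., $(S,V)$ is a $\mathbb{Q}$-VASR abstraction of $F$). Moreover, if $F$ is in $\exists$LRA, then the returned $(S,V)$ is a best $\mathbb{Q}$-VASR abstraction of $F$.
   Context: $\exists$LIRA formulas are built from atoms $s<t$ and $s=t$ over linear terms with rational coefficients using $\land$, $\lor$, $\exists x\in\mathbb{Q}$ and $\exists x \in \mathbb{Z}$; $\exists$LRA is the fragment without quantification over $\mathbb{Z}$. A transition formula of dimension $n$ is a formula $F(\vec x,\vec x')$ with free variables $\vec x=x_1,\dots,x_n$ and $\vec x'=x_1',\dots,x_n'$; it defines the transition system on $\mathbb{Q}^n$ with $\vec u \to_F \vec v$ iff $F(\vec u,\vec v)$ holds. A $\mathbb{Q}$-VASR of dimension $d$ is a finite set $V\subseteq\{0,1\}^d\times\mathbb{Q}^d$ of transformers $(\vec r,\vec a)$; it defines the transition system on $\mathbb{Q}^d$ with $\vec u\to_V\vec v$ iff $\vec v=\vec r*\vec u+\vec a$ for some $(\vec r,\vec a)\in V$, where $*$ is the pointwise product. For transition systems $A=(\mathbb{Q}^n,\to_A)$, $B=(\mathbb{Q}^m,\to_B)$, a linear simulation $A\Vdash_S B$ is a matrix $S\in\mathbb{Q}^{m\times n}$ such that $\vec u\to_A\vec v$ implies $S\vec u\to_B S\vec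 v$. A $\mathbb{Q}$-VASR abstraction is a pair $(S,V)$ with $S\in\mathbb{Q}^{d\times n}$ and $V$ a $d$-dimensional $\mathbb{Q}$-VASR; it is an abstraction of $F$ if $F\Vdash_S V$. Preorder: $(S^1,V^1)\preceq(S^2,V^2)$ (abstract dimensions $d$, $e$) iff there is $T\in\mathbb{Q}^{e\times d}$ with $V^1\Vdash_T V^2$ and $TS^1=S^2$. A best $\mathbb{Q}$-VASR abstraction of $F$ is an abstraction $(S,V)$ of $F$ with $(S,V)\preceq(\widetilde S,\widetilde V)$ for every $\mathbb{Q}$-VASR abstraction $(\widetilde S,\widetilde V)$ of $F$. For a $\mathbb{Q}$-VASR abstraction $(S,V)$ let $\gamma(S,V)\triangleq\bigvee_{(\vec r,\vec a)\in V} S\vec x'=\vec r*(S\vec x)+\vec a$. $\hat\alpha$: for a consistent conjunctive transition formula $C$ of dimension $n$, let $\mathit{Res}_C=\{(\vec s,a)\in\mathbb{Q}^n\times\mathbb{Q}: C\models \vec s\cdot\vec x'=a\}$ and $\mathit{Inc}_C=\{(\vec s,a): C\models\vec s\cdot\vec x'=\vec s\cdot\vec x+a\}$ (vector spaces). Choose a basis $(\vec s_1,a_1),\dots,(\vec s_m,a_m)$ of $\mathit{Res}_C$ and a basis $(\vec s_{m+1},a_{m+1}),\dots,(\vec s_d,a_d)$ of $\mathit{Inc}_C$, and set $\hat\alpha(C)=(S,\{(\vec r,\vec a)\})$ where $S$ has rows $\vec s_1,\dots,\vec s_d$, $\vec r=(0,\dots,0,1,\dots,1)$ ($m$ zeros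 then $d-m$ ones), $\vec a=(a_1,\dots,a_d)$. Coherence: dimensions $i,j$ of a $d$-dimensional $\mathbb{Q}$-VASR $V$ are coherent if $r_i=r_j$ for all $(\vec r,\vec a)\in V$; the equivalence classes are the coherence classes of $V$. For a coherence class $C=\{c_1<\dots<c_k\}$, $\pi_C$ is the $k\times d$ matrix with rows $\vec e_{c_1},\dots,\vec e_{c_k}$. A matrix $T\in\mathbb{Q}^{e\times d}$ is coherent w.r.t. $V$ if each row has its nonzero entries only in columns of a single coherence class. For $T$ coherent w.r.t. $V$ with no zero rows, $\mathrm{image}(V,T)=\{(T\rhd\vec r,T\vec a):(\vec r,\vec a)\in V\}$ where $(T\rhd\vec r)_i=r_j$ for any $j$ with $T_{ij}\neq0$. For matrices $A,B$ with the same number of columns, $\mathit{pushout}(A,B)$ returns $(U^1,U^2)$ whose row pairs $(U^1_i,U^2_i)$ form a basis of $\{(\vec u^1,\vec u^2):\vec u^1A=\vec u^2B\}$. Join $(S^1,V^1)\sqcup(S^2,V^2)$ (equal concrete dimension): start with empty $S,T^1,T^2$; for each coherence class $C^1$ of $V^1$ and each coherence class $C^2$ of $V^2$, let $(U^1,U^2)=\mathit{pushout}(\pi_{C^1}S^1,\pi_{C^2}S^2)$ and append the rows of $U^1\pi_{C^1}S^1$ to $S$, of $U^1\pi_{C^1}$ to $T^1$, and of $U^2\pi_{C^2}$ to $T^2$; finally let $V=\mathrm{image}(V^1,T^1)\cup\mathrm{image}(V^2,T^2)$ and return $(S,V)$. Algorithm abstract-VASR$(F)$: Skolemize the existentials of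 $F$; set $(S,V)\gets(I_n,\emptyset)$ and $\Gamma\gets F$; while $\Gamma$ is satisfiable: let $M$ be a model of $\Gamma$, let $C$ be a cube (disjunct) of the DNF of $F$ with $M\models C$, set $(S,V)\gets(S,V)\sqcup\hat\alpha(C)$ and $\Gamma\gets\Gamma\land\lnot\gamma(S,V)$; return $(S,V)$. *)

theory Defs
  imports "Jordan_Normal_Form.Matrix"
begin

text \<open>Variables: pre-state variables x_i (Pre i), post-state variables x_i' (Post i),
  user-chosen names for bound variables (Bnd k), and Skolem constants (Sk p), where p is
  the position (path) of the eliminated quantifier in the formula tree.\<close>

datatype var = Pre nat | Post nat | Bnd nat | Sk "nat list"

datatype lterm = LConst rat | LVar var | LAdd lterm lterm | LScale rat lterm

datatype atom = Lt lterm lterm | Eq lterm lterm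

datatype fm = Atom atom | And fm fm | Or fm fm | ExQ var fm | ExZ var fm

fun lt_eval :: "(var \<Rightarrow> rat) \<Rightarrow> lterm \<Rightarrow> rat" where
  "lt_eval M (LConst c) = c"
| "lt_eval M (LVar x) = M x"
| "lt_eval M (LAdd s t) = lt_eval M s + lt_eval M t"
| "lt_eval M (LScale c t) = c * lt_eval M t"

fun atom_sem :: "(var \<Rightarrow> rat) \<Rightarrow> atom \<Rightarrow> bool" where
  "atom_sem M (Lt s t) = (lt_eval M s < lt_eval M t)"
| "atom_sem M (Eq s t) = (lt_eval M s = lt_eval M t)"

fun sem :: "(var \<Rightarrow> rat) \<Rightarrow> fm \<Rightarrow> bool" where
  "sem M (Atom a) = atom_sem M a"
| "sem M (And f g) = (sem M f \<and> sem M g)"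
| "sem M (Or f g) = (sem M f \<or> sem M g)"
| "sem M (ExQ x f) = (\<exists>q. sem (M(x := q)) f)"
| "sem M (ExZ x f) = (\<exists>q\<in>\<int>. sem (M(x := q)) f)"

fun lt_vars :: "lterm \<Rightarrow> var set" where
  "lt_vars (LConst c) = {}"
| "lt_vars (LVar x) = {x}"
| "lt_vars (LAdd s t) = lt_vars s \<union> lt_vars t"
| "lt_vars (LScale c t) = lt_vars t"

fun atom_vars :: "atom \<Rightarrow> var set" where
  "atom_vars (Lt s t) = lt_vars s \<union> lt_vars t"
| "atom_vars (Eq s t) = lt_vars s \<union> lt_vars t"

fun fv :: "fm \<Rightarrow> var set" where
  "fv (Atom a) = atom_vars a"
| "fv (And f g) = fv f \<union> fv g"
| "fv (Or f g) = fv f \<union> fv g"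
| "fv (ExQ x f) = fv f - {x}"
| "fv (ExZ x f) = fv f - {x}"

fun is_lra :: "fm \<Rightarrow> bool" where
  "is_lra (Atom a) = True"
| "is_lra (And f g) = (is_lra f \<and> is_lra g)"
| "is_lra (Or f g) = (is_lra f \<and> is_lra g)"
| "is_lra (ExQ x f) = is_lra f"
| "is_lra (ExZ x f) = False"

definition transition_formula :: "nat \<Rightarrow> fm \<Rightarrow> bool" where
  "transition_formula n F \<longleftrightarrow> fv F \<subseteq> {Pre i | i. i < n} \<union> {Post i | i. i < n}"

definition pre_vec :: "nat \<Rightarrow> (var \<Rightarrow> rat) \<Rightarrow> rat vec" where
  "pre_vec n M = vec n (\<lambda>i. M (Pre i))"

definition post_vec :: "nat \<Rightarrow> (var \<Rightarrow> rat) \<Rightarrow> rat vec" where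
  "post_vec n M = vec n (\<lambda>i. M (Post i))"

definition tf_step :: "nat \<Rightarrow> fm \<Rightarrow> rat vec \<Rightarrow> rat vec \<Rightarrow> bool" where
  "tf_step n F u v \<longleftrightarrow> u \<in> carrier_vec n \<and> v \<in> carrier_vec n \<and>
     (\<exists>M. pre_vec n M = u \<and> post_vec n M = v \<and> sem M F)"

definition pmul :: "rat vec \<Rightarrow> rat vec \<Rightarrow> rat vec" where
  "pmul r u = vec (dim_vec u) (\<lambda>i. r $ i * u $ i)"

definition is_vasr :: "nat \<Rightarrow> (rat vec \<times> rat vec) set \<Rightarrow> bool" where
  "is_vasr d V \<longleftrightarrow> finite V \<and> (\<forall>(r, a) \<in> V. r \<in> carrier_vec d \<and> a \<in> carrier_vec d \<and>
     (\<forall>i < d. r $ i = 0 \<or> r $ i = 1))"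

definition vasr_step :: "nat \<Rightarrow> (rat vec \<times> rat vec) set \<Rightarrow> rat vec \<Rightarrow> rat vec \<Rightarrow> bool" where
  "vasr_step d V u v \<longleftrightarrow> u \<in> carrier_vec d \<and> v \<in> carrier_vec d \<and>
     (\<exists>(r, a) \<in> V. v = pmul r u + a)"

definition lin_sim :: "(rat vec \<Rightarrow> rat vec \<Rightarrow> bool) \<Rightarrow> rat mat \<Rightarrow> (rat vec \<Rightarrow> rat vec \<Rightarrow> bool) \<Rightarrow> bool" where
  "lin_sim A S B \<longleftrightarrow> (\<forall>u v. A u v \<longrightarrow> B (S *\<^sub>v u) (S *\<^sub>v v))"

definition vasr_abstraction :: "nat \<Rightarrow> fm \<Rightarrow> rat mat \<Rightarrow> (rat vec \<times> rat vec) set \<Rightarrow> bool" where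
  "vasr_abstraction n F S V \<longleftrightarrow> S \<in> carrier_mat (dim_row S) n \<and> is_vasr (dim_row S) V \<and>
     lin_sim (tf_step n F) S (vasr_step (dim_row S) V)"

definition abs_le :: "rat mat \<times> (rat vec \<times> rat vec) set \<Rightarrow> rat mat \<times> (rat vec \<times> rat vec) set \<Rightarrow> bool" where
  "abs_le A1 A2 \<longleftrightarrow> (case (A1, A2) of ((S1, V1), (S2, V2)) \<Rightarrow>
     (\<exists>T \<in> carrier_mat (dim_row S2) (dim_row S1).
        lin_sim (vasr_step (dim_row S1) V1) T (vasr_step (dim_row S2) V2) \<and> T * S1 = S2))"

definition best_abstraction :: "nat \<Rightarrow> fm \<Rightarrow> rat mat \<Rightarrow> (rat vec \<times> rat vec) set \<Rightarrow> bool" where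
  "best_abstraction n F S V \<longleftrightarrow> vasr_abstraction n F S V \<and>
     (\<forall>S' V'. vasr_abstraction n F S' V' \<longrightarrow> abs_le (S, V) (S', V'))"

datatype qf = QAtom atom | QAnd qf qf | QOr qf qf

fun lt_ren :: "(var \<Rightarrow> var) \<Rightarrow> lterm \<Rightarrow> lterm" where
  "lt_ren \<sigma> (LConst c) = LConst c"
| "lt_ren \<sigma> (LVar x) = LVar (\<sigma> x)"
| "lt_ren \<sigma> (LAdd s t) = LAdd (lt_ren \<sigma> s) (lt_ren \<sigma> t)"
| "lt_ren \<sigma> (LScale c t) = LScale c (lt_ren \<sigma> t)"

fun atom_ren :: "(var \<Rightarrow> var) \<Rightarrow> atom \<Rightarrow> atom" where
  "atom_ren \<sigma> (Lt s t) = Lt (lt_ren \<sigma> s) (lt_ren \<sigma> t)"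
| "atom_ren \<sigma> (Eq s t) = Eq (lt_ren \<sigma> s) (lt_ren \<sigma> t)"

fun skol :: "nat list \<Rightarrow> (var \<Rightarrow> var) \<Rightarrow> fm \<Rightarrow> qf" where
  "skol p \<sigma> (Atom a) = QAtom (atom_ren \<sigma> a)"
| "skol p \<sigma> (And f g) = QAnd (skol (0 # p) \<sigma> f) (skol (1 # p) \<sigma> g)"
| "skol p \<sigma> (Or f g) = QOr (skol (0 # p) \<sigma> f) (skol (1 # p) \<sigma> g)"
| "skol p \<sigma> (ExQ x f) = skol (0 # p) (\<sigma>(x := Sk p)) f"
| "skol p \<sigma> (ExZ x f) = skol (0 # p) (\<sigma>(x := Sk p)) f"

fun skol_int :: "nat list \<Rightarrow> fm \<Rightarrow> var set" where
  "skol_int p (Atom a) = {}"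
| "skol_int p (And f g) = skol_int (0 # p) f \<union> skol_int (1 # p) g"
| "skol_int p (Or f g) = skol_int (0 # p) f \<union> skol_int (1 # p) g"
| "skol_int p (ExQ x f) = skol_int (0 # p) f"
| "skol_int p (ExZ x f) = insert (Sk p) (skol_int (0 # p) f)"

definition skolem :: "fm \<Rightarrow> qf" where "skolem F = skol [] id F"
definition int_syms :: "fm \<Rightarrow> var set" where "int_syms F = skol_int [] F"

fun qsem :: "(var \<Rightarrow> rat) \<Rightarrow> qf \<Rightarrow> bool" where
  "qsem M (QAtom a) = atom_sem M a"
| "qsem M (QAnd f g) = (qsem M f \<and> qsem M g)"
| "qsem M (QOr f g) = (qsem M f \<or> qsem M g)"

fun dnf :: "qf \<Rightarrow> atom list list" where
  "dnf (QAtom a) = [[a]]"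
| "dnf (QAnd f g) = [c1 @ c2. c1 \<leftarrow> dnf f, c2 \<leftarrow> dnf g]"
| "dnf (QOr f g) = dnf f @ dnf g"

definition cube_sem :: "(var \<Rightarrow> rat) \<Rightarrow> atom list \<Rightarrow> bool" where
  "cube_sem M C \<longleftrightarrow> (\<forall>a \<in> set C. atom_sem M a)"

definition int_ok :: "var set \<Rightarrow> (var \<Rightarrow> rat) \<Rightarrow> bool" where
  "int_ok Z M \<longleftrightarrow> (\<forall>z \<in> Z. M z \<in> \<int>)"

definition lincomb :: "nat \<Rightarrow> (nat \<Rightarrow> rat) \<Rightarrow> rat vec list \<Rightarrow> rat vec" where
  "lincomb N c L = vec N (\<lambda>j. \<Sum>i < length L. c i * L ! i $ j)"

definition is_basis :: "nat \<Rightarrow> rat vec set \<Rightarrow> rat vec list \<Rightarrow> bool" where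
  "is_basis N W L \<longleftrightarrow> set L \<subseteq> W \<and>
     (\<forall>c. lincomb N c L = 0\<^sub>v N \<longrightarrow> (\<forall>i < length L. c i = 0)) \<and>
     (\<forall>w \<in> W. \<exists>c. w = lincomb N c L)"

definition pair_vec :: "rat vec \<Rightarrow> rat \<Rightarrow> rat vec" where
  "pair_vec s a = s @\<^sub>v vec 1 (\<lambda>_. a)"

definition Res :: "nat \<Rightarrow> var set \<Rightarrow> atom list \<Rightarrow> rat vec set" where
  "Res n Z C = {pair_vec s a | s a. s \<in> carrier_vec n \<and>
     (\<forall>M. int_ok Z M \<longrightarrow> cube_sem M C \<longrightarrow> s \<bullet> post_vec n M = a)}"

definition Inc :: "nat \<Rightarrow> var set \<Rightarrow> atom list \<Rightarrow> rat vec set" where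
  "Inc n Z C = {pair_vec s a | s a. s \<in> carrier_vec n \<and>
     (\<forall>M. int_ok Z M \<longrightarrow> cube_sem M C \<longrightarrow> s \<bullet> post_vec n M = s \<bullet> pre_vec n M + a)}"

text \<open>alpha-hat (nondeterministic in the choice of bases).\<close>
definition alpha_hat :: "nat \<Rightarrow> var set \<Rightarrow> atom list \<Rightarrow> rat mat \<times> (rat vec \<times> rat vec) set \<Rightarrow> bool" where
  "alpha_hat n Z C A \<longleftrightarrow> (\<exists>S V m d a. A = (S, V) \<and> S \<in> carrier_mat d n \<and> a \<in> carrier_vec d \<and> m \<le> d \<and>
     is_basis (n+1) (Res n Z C) (map (\<lambda>i. pair_vec (row S i) (a $ i)) [0..<m]) \<and>
     is_basis (n+1) (Inc n Z C) (map (\<lambda>i. pair_vec (row S i) (a $ i)) [m..<d]) \<and>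
     V = {(vec d (\<lambda>i. if i < m then 0 else 1), a)})"

definition coherence_classes :: "nat \<Rightarrow> (rat vec \<times> rat vec) set \<Rightarrow> nat set set" where
  "coherence_classes d V = {{j. j < d \<and> (\<forall>(r, a) \<in> V. r $ j = r $ i)} | i. i < d}"

definition proj :: "nat \<Rightarrow> nat set \<Rightarrow> rat mat" where
  "proj d C = mat_of_rows d (map (unit_vec d) (sorted_list_of_set C))"

definition stack :: "nat \<Rightarrow> rat mat list \<Rightarrow> rat mat" where
  "stack c Ms = mat_of_rows c (concat (map rows Ms))"

definition pushout :: "rat mat \<Rightarrow> rat mat \<Rightarrow> rat mat \<times> rat mat \<Rightarrow> bool" where
  "pushout A B U \<longleftrightarrow> (\<exists>U1 U2 p. U = (U1, U2) \<and>
     U1 \<in> carrier_mat p (dim_row A) \<and> U2 \<in> carrier_mat p (dim_row B) \<and>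
     is_basis (dim_row A + dim_row B)
       {w \<in> carrier_vec (dim_row A + dim_row B).
          transpose_mat A *\<^sub>v vec_first w (dim_row A) = transpose_mat B *\<^sub>v vec_last w (dim_row B)}
       (map (\<lambda>i. row U1 i @\<^sub>v row U2 i) [0..<p]))"

text \<open>(T |> r)_i = r_j for any j with T_ij nonzero (for a zero row, which does not occur
  in the paper's setting, we use 0).\<close>
definition tri :: "rat mat \<Rightarrow> rat vec \<Rightarrow> rat vec" where
  "tri T r = vec (dim_row T) (\<lambda>i. if \<exists>j < dim_col T. T $$ (i, j) \<noteq> 0
       then r $ (SOME j. j < dim_col T \<and> T $$ (i, j) \<noteq> 0) else 0)"

definition image_vasr :: "(rat vec \<times> rat vec) set \<Rightarrow> rat mat \<Rightarrow> (rat vec \<times> rat vec) set" where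
  "image_vasr V T = (\<lambda>(r, a). (tri T r, T *\<^sub>v a)) ` V"

text \<open>Join (nondeterministic in the enumeration order of class pairs and in the pushout bases).\<close>
definition join :: "nat \<Rightarrow> rat mat \<times> (rat vec \<times> rat vec) set \<Rightarrow> rat mat \<times> (rat vec \<times> rat vec) set
    \<Rightarrow> rat mat \<times> (rat vec \<times> rat vec) set \<Rightarrow> bool" where
  "join n A1 A2 A \<longleftrightarrow> (case (A1, A2) of ((S1, V1), (S2, V2)) \<Rightarrow>
     (\<exists>ps Us. distinct ps \<and>
        set ps = coherence_classes (dim_row S1) V1 \<times> coherence_classes (dim_row S2) V2 \<and>
        length Us = length ps \<and>
        (\<forall>k < length ps. pushout (proj (dim_row S1) (fst (ps ! k)) * S1)
                                 (proj (dim_row S2) (snd (ps ! k)) * S2) (Us ! k)) \<and>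
        (let T1 = stack (dim_row S1) (map (\<lambda>k. fst (Us ! k) * proj (dim_row S1) (fst (ps ! k))) [0..<length ps]);
             T2 = stack (dim_row S2) (map (\<lambda>k. snd (Us ! k) * proj (dim_row S2) (snd (ps ! k))) [0..<length ps])
         in A = (stack n (map (\<lambda>k. fst (Us ! k) * proj (dim_row S1) (fst (ps ! k)) * S1) [0..<length ps]),
                 image_vasr V1 T1 \<union> image_vasr V2 T2))))"

definition gamma :: "rat mat \<Rightarrow> (rat vec \<times> rat vec) set \<Rightarrow> rat vec \<Rightarrow> rat vec \<Rightarrow> bool" where
  "gamma S V u v \<longleftrightarrow> (\<exists>(r, a) \<in> V. S *\<^sub>v v = pmul r (S *\<^sub>v u) + a)"

type_synonym av_state = "rat mat \<times> (rat vec \<times> rat vec) set \<times> ((var \<Rightarrow> rat) \<Rightarrow> bool)"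

text \<open>The formula Gamma is represented by its set of models (interpretations of the
  variables and Skolem constants, respecting sorts).\<close>
definition av_init :: "nat \<Rightarrow> fm \<Rightarrow> av_state" where
  "av_init n F = (1\<^sub>m n, {}, \<lambda>M. int_ok (int_syms F) M \<and> qsem M (skolem F))"

definition av_step :: "nat \<Rightarrow> fm \<Rightarrow> av_state \<Rightarrow> av_state \<Rightarrow> bool" where
  "av_step n F st st' \<longleftrightarrow> (case (st, st') of ((S, V, G), (S', V', G')) \<Rightarrow>
     (\<exists>M C A. G M \<and> C \<in> set (dnf (skolem F)) \<and> cube_sem M C \<and>
        alpha_hat n (int_syms F) C A \<and> join n (S, V) A (S', V') \<and>
        G' = (\<lambda>M'. G M' \<and> \<not> gamma S' V' (pre_vec n M') (post_vec n M'))))"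

definition av_final :: "av_state \<Rightarrow> bool" where
  "av_final st \<longleftrightarrow> (case st of (S, V, G) \<Rightarrow> \<not> (\<exists>M. G M))"

end

theory Submission
  imports Defs "HOL-Library.Sublist"
begin

text \<open>Each step chooses a cube of the DNF that still has a model of \<open>\<Gamma>\<close>; since the join
  over-approximates both arguments, that cube has no model of \<open>\<Gamma>\<close> afterwards. So every step
  uses up a cube, and at the end every model of \<open>F\<close> is covered. The join is a least upper bound
  only for abstractions that are \<^emph>\<open>normal\<close> (the rows of \<open>S\<close> belonging to one coherence class are
  linearly independent), and normality holds initially and is preserved. For linear real arithmetic
  a cube defines a convex set; a convex set covered by finitely many affine
  subspaces lies in one of them, so any abstraction of \<open>F\<close> simulates a given cube by a single
  transformer and hence factors through \<open>\<alpha>\<close>-hat of that cube.\<close>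

text \<open>The preorder compares transition systems state by state, so the target transformer may
  vary with the state. The induction carries the stronger \<open>uniform_sim\<close>, which fixes
  one target transformer per source transformer. This confines each row of a simulation matrix to a
  single coherence class, and a row so confined is what the pushout of two classes can capture. The
  condition is vacuous for the empty transformer set at the start and is weakened to
  \<open>lin_sim\<close> only at the end. Normality keeps the two sides of a join in step. If rows
  of one class were dependent, a nontrivial combination of them could vanish on the concrete states,
  so a row could be zero on one side and nonzero on the other, and the zero side would leave its
  reset factor undetermined. For \<alpha>-hat, normality comes from the consistency of the cube: a
  model makes each offset a linear function of its row. For linear real arithmetic, optimality is a
  lower bound kept throughout: every intermediate pair lies below all abstractions of
  \<open>F\<close>, and the emptiness of \<Gamma> finally makes it an abstraction itself.\<close>

subsection \<open>Skolemization\<close>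

lemma lt_eval_ren: "lt_eval M (lt_ren \<sigma> t) = lt_eval (\<lambda>x. M (\<sigma> x)) t"
  by (induction t) auto

lemma atom_sem_ren: "atom_sem M (atom_ren \<sigma> a) = atom_sem (\<lambda>x. M (\<sigma> x)) a"
  by (cases a) (auto simp: lt_eval_ren)

lemma lt_eval_cong: "(\<And>x. x \<in> lt_vars t \<Longrightarrow> M x = N x) \<Longrightarrow> lt_eval M t = lt_eval N t"
  by (induction t) auto

lemma atom_sem_cong:
  assumes "\<And>x. x \<in> atom_vars a \<Longrightarrow> M x = N x"
  shows "atom_sem M a = atom_sem N a"
  using assms lt_eval_cong[of _ M N] by (cases a) fastforce+

lemma qsem_skol_imp_sem:
  "qsem M (skol p \<sigma> f) \<Longrightarrow> int_ok (skol_int p f) M \<Longrightarrow> sem (\<lambda>x. M (\<sigma> x)) f"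
proof (induction f arbitrary: p \<sigma>)
  case (ExQ x f)
  then have "sem (\<lambda>y. M ((\<sigma>(x := Sk p)) y)) f" by fastforce
  moreover have "(\<lambda>y. M ((\<sigma>(x := Sk p)) y)) = (\<lambda>y. M (\<sigma> y))(x := M (Sk p))" by auto
  ultimately show ?case by auto
next
  case (ExZ x f)
  then have "sem (\<lambda>y. M ((\<sigma>(x := Sk p)) y)) f" by (fastforce simp: int_ok_def)
  moreover have "(\<lambda>y. M ((\<sigma>(x := Sk p)) y)) = (\<lambda>y. M (\<sigma> y))(x := M (Sk p))" by auto
  moreover have "M (Sk p) \<in> \<int>" using ExZ.prems by (auto simp: int_ok_def)
  ultimately show ?case by auto
qed (auto simp: atom_sem_ren int_ok_def)

text \<open>Paths grow at the front, so positions in the subtree at \<open>p\<close> have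
  \<open>p\<close> as a suffix. All freshness arguments below are phrased through
  \<open>suffix\<close>.\<close>

lemma skol_int_suffix: "z \<in> skol_int p f \<Longrightarrow> \<exists>q. z = Sk q \<and> suffix p q"
  by (induction f arbitrary: p) (fastforce dest: suffix_ConsD)+

lemma int_ok_skol_int:
  "(\<And>q. suffix p q \<Longrightarrow> M (Sk q) \<in> \<int>) \<Longrightarrow> int_ok (skol_int p f) M"
  unfolding int_ok_def using skol_int_suffix by blast

lemma qsem_skol_cong:
  "(\<And>x. x \<in> fv f \<Longrightarrow> M (\<sigma> x) = N (\<sigma> x)) \<Longrightarrow> (\<And>q. suffix p q \<Longrightarrow> M (Sk q) = N (Sk q)) \<Longrightarrow>
   qsem M (skol p \<sigma> f) = qsem N (skol p \<sigma> f)"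
proof (induction f arbitrary: p \<sigma>)
  case (Atom a)
  then show ?case by (auto simp: atom_sem_ren intro!: atom_sem_cong)
next
  case (And f g)
  have "qsem M (skol (0 # p) \<sigma> f) = qsem N (skol (0 # p) \<sigma> f)"
    using And.prems by (intro And.IH) (auto dest: suffix_ConsD)
  moreover have "qsem M (skol (1 # p) \<sigma> g) = qsem N (skol (1 # p) \<sigma> g)"
    using And.prems by (intro And.IH) (auto dest: suffix_ConsD)
  ultimately show ?case by simp
next
  case (Or f g)
  have "qsem M (skol (0 # p) \<sigma> f) = qsem N (skol (0 # p) \<sigma> f)"
    using Or.prems by (intro Or.IH) (auto dest: suffix_ConsD)
  moreover have "qsem M (skol (1 # p) \<sigma> g) = qsem N (skol (1 # p) \<sigma> g)"
    using Or.prems by (intro Or.IH) (auto dest: suffix_ConsD)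
  ultimately show ?case by simp
next
  case (ExQ x f)
  show ?case unfolding skol.simps using ExQ.prems by (intro ExQ.IH) (auto dest: suffix_ConsD)
next
  case (ExZ x f)
  show ?case unfolding skol.simps using ExZ.prems by (intro ExZ.IH) (auto dest: suffix_ConsD)
qed

text \<open>Disjoint subtrees own disjoint sets of Skolem constants, so the witnesses for two
  conjuncts can be chosen one after the other.\<close>

lemma not_suffix_sibling:
  "suffix (a # p) q \<Longrightarrow> a \<noteq> b \<Longrightarrow> \<not> suffix (b # p) q"
  by (auto simp: suffix_def)

lemma not_suffix_Cons_self: "\<not> suffix (a # p) p"
  by (auto simp: suffix_def)

text \<open>The witnesses are collected in \<open>M'\<close>, which may differ from \<open>M\<close>
  only at Skolem constants below \<open>p\<close>. The third premise keeps the renamed free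
  variables outside that region, so later choices do not disturb them. The fourth makes
  \<open>M\<close> itself a legal default at every integer constant for which no witness is
  chosen.\<close>

lemma sem_imp_qsem_skol:
  assumes "sem N f" "\<And>x. x \<in> fv f \<Longrightarrow> M (\<sigma> x) = N x"
    and "\<And>x q. x \<in> fv f \<Longrightarrow> suffix p q \<Longrightarrow> \<sigma> x \<noteq> Sk q"
    and "\<And>q. suffix p q \<Longrightarrow> M (Sk q) \<in> \<int>"
  shows "\<exists>M'. (\<forall>y. (\<forall>q. suffix p q \<longrightarrow> y \<noteq> Sk q) \<longrightarrow> M' y = M y) \<and>
    int_ok (skol_int p f) M' \<and> qsem M' (skol p \<sigma> f)"
  using assms
proof (induction f arbitrary: p \<sigma> N M)
  case (Atom a)
  have "atom_sem (\<lambda>x. M (\<sigma> x)) a = atom_sem N a" by (rule atom_sem_cong) (use Atom in auto)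
  then show ?case using Atom by (intro exI[of _ M]) (auto simp: int_ok_def atom_sem_ren)
next
  case (And f g)
  have "\<exists>M'. (\<forall>y. (\<forall>q. suffix (0 # p) q \<longrightarrow> y \<noteq> Sk q) \<longrightarrow> M' y = M y) \<and>
    int_ok (skol_int (0 # p) f) M' \<and> qsem M' (skol (0 # p) \<sigma> f)"
    by (rule And.IH(1)[of N]) (use And.prems in \<open>auto dest: suffix_ConsD\<close>)
  then obtain M1 where M1: "\<And>y. (\<forall>q. suffix (0 # p) q \<longrightarrow> y \<noteq> Sk q) \<Longrightarrow> M1 y = M y"
    "int_ok (skol_int (0 # p) f) M1" "qsem M1 (skol (0 # p) \<sigma> f)" by blast
  have M1_eq: "M1 (\<sigma> x) = N x" if "x \<in> fv (And f g)" for x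
    using M1(1)[of "\<sigma> x"] And.prems that by (metis suffix_ConsD)
  have M1_Sk: "M1 (Sk q) = M (Sk q)" if "suffix (1 # p) q" for q
    using M1(1)[of "Sk q"] not_suffix_sibling[OF that, of 0] by auto
  have "\<exists>M'. (\<forall>y. (\<forall>q. suffix (1 # p) q \<longrightarrow> y \<noteq> Sk q) \<longrightarrow> M' y = M1 y) \<and>
    int_ok (skol_int (1 # p) g) M' \<and> qsem M' (skol (1 # p) \<sigma> g)"
    by (rule And.IH(2)[of N]) (use And.prems M1_eq M1_Sk in \<open>auto dest: suffix_ConsD\<close>)
  then obtain M2 where M2: "\<And>y. (\<forall>q. suffix (1 # p) q \<longrightarrow> y \<noteq> Sk q) \<Longrightarrow> M2 y = M1 y"
    "int_ok (skol_int (1 # p) g) M2" "qsem M2 (skol (1 # p) \<sigma> g)" by blast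
  \<comment> \<open>The choices for the second conjunct leave the constants of the first alone, so
    the first conjunct remains true when passing from \<open>M1\<close> to
    \<open>M2\<close>.\<close>
  have M2_eq: "M2 (Sk q) = M1 (Sk q)" if "suffix (0 # p) q" for q
    using M2(1)[of "Sk q"] not_suffix_sibling[OF that, of 1] by auto
  have "M2 (\<sigma> x) = M1 (\<sigma> x)" if "x \<in> fv f" for x
    using M2(1)[of "\<sigma> x"] And.prems that by (metis suffix_ConsD fv.simps(2) UnCI)
  with M2_eq have "qsem M2 (skol (0 # p) \<sigma> f) = qsem M1 (skol (0 # p) \<sigma> f)"
    by (intro qsem_skol_cong) auto
  moreover have "int_ok (skol_int (0 # p) f) M2"
    using M1(2) M2_eq skol_int_suffix unfolding int_ok_def by metis
  moreover have "\<forall>y. (\<forall>q. suffix p q \<longrightarrow> y \<noteq> Sk q) \<longrightarrow> M2 y = M y"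
    using M1(1) M2(1) by (metis suffix_ConsD)
  ultimately show ?case using M1 M2 by (intro exI[of _ M2]) (auto simp: int_ok_def)
next
  case (Or f g)
  from Or.prems(1) consider "sem N f" | "sem N g" by auto
  then show ?case
  proof cases
    case 1
    have "\<exists>M'. (\<forall>y. (\<forall>q. suffix (0 # p) q \<longrightarrow> y \<noteq> Sk q) \<longrightarrow> M' y = M y) \<and>
      int_ok (skol_int (0 # p) f) M' \<and> qsem M' (skol (0 # p) \<sigma> f)"
      by (rule Or.IH(1)[of N]) (use 1 Or.prems in \<open>auto dest: suffix_ConsD\<close>)
    then obtain M1 where M1: "\<And>y. (\<forall>q. suffix (0 # p) q \<longrightarrow> y \<noteq> Sk q) \<Longrightarrow> M1 y = M y"
      "int_ok (skol_int (0 # p) f) M1" "qsem M1 (skol (0 # p) \<sigma> f)" by blast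
    \<comment> \<open>\<open>int_ok\<close> also covers the disjunct that was not chosen; its
      constants keep their integral values from \<open>M\<close>.\<close>
    have "M1 (Sk q) = M (Sk q)" if "suffix (1 # p) q" for q
      using M1(1)[of "Sk q"] not_suffix_sibling[OF that, of 0] by auto
    then have "int_ok (skol_int (1 # p) g) M1"
      using Or.prems(4) by (intro int_ok_skol_int) (auto dest: suffix_ConsD)
    moreover have "\<forall>y. (\<forall>q. suffix p q \<longrightarrow> y \<noteq> Sk q) \<longrightarrow> M1 y = M y"
      using M1(1) by (metis suffix_ConsD)
    ultimately show ?thesis using M1(2,3) by (intro exI[of _ M1]) (simp add: int_ok_def ball_Un)
  next
    case 2
    have "\<exists>M'. (\<forall>y. (\<forall>q. suffix (1 # p) q \<longrightarrow> y \<noteq> Sk q) \<longrightarrow> M' y = M y) \<and>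
      int_ok (skol_int (1 # p) g) M' \<and> qsem M' (skol (1 # p) \<sigma> g)"
      by (rule Or.IH(2)[of N]) (use 2 Or.prems in \<open>auto dest: suffix_ConsD\<close>)
    then obtain M1 where M1: "\<And>y. (\<forall>q. suffix (1 # p) q \<longrightarrow> y \<noteq> Sk q) \<Longrightarrow> M1 y = M y"
      "int_ok (skol_int (1 # p) g) M1" "qsem M1 (skol (1 # p) \<sigma> g)" by blast
    have "M1 (Sk q) = M (Sk q)" if "suffix (0 # p) q" for q
      using M1(1)[of "Sk q"] not_suffix_sibling[OF that, of 1] by auto
    then have "int_ok (skol_int (0 # p) f) M1"
      using Or.prems(4) by (intro int_ok_skol_int) (auto dest: suffix_ConsD)
    moreover have "\<forall>y. (\<forall>q. suffix p q \<longrightarrow> y \<noteq> Sk q) \<longrightarrow> M1 y = M y"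
      using M1(1) by (metis suffix_ConsD)
    ultimately show ?thesis using M1(2,3) by (intro exI[of _ M1]) (simp add: int_ok_def ball_Un)
  qed
next
  case (ExQ x f)
  then obtain c where c: "sem (N(x := c)) f" by auto
  \<comment> \<open>The rational \<open>c\<close> may be non-integral. It is stored at
    \<open>Sk p\<close>, which is not below \<open>0 # p\<close>, so the integrality premise of the
    induction hypothesis still holds.\<close>
  have "\<exists>M'. (\<forall>y. (\<forall>q. suffix (0 # p) q \<longrightarrow> y \<noteq> Sk q) \<longrightarrow> M' y = (M(Sk p := c)) y) \<and>
    int_ok (skol_int (0 # p) f) M' \<and> qsem M' (skol (0 # p) (\<sigma>(x := Sk p)) f)"
    by (rule ExQ.IH[OF c])
      (use ExQ.prems in \<open>auto dest: suffix_ConsD simp: not_suffix_Cons_self\<close>)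
  then obtain M' where M': "\<And>y. (\<forall>q. suffix (0 # p) q \<longrightarrow> y \<noteq> Sk q) \<Longrightarrow> M' y = (M(Sk p := c)) y"
    "int_ok (skol_int (0 # p) f) M'" "qsem M' (skol (0 # p) (\<sigma>(x := Sk p)) f)" by blast
  have "M' y = M y" if "\<forall>q. suffix p q \<longrightarrow> y \<noteq> Sk q" for y
    using M'(1)[of y] that by (metis suffix_ConsD suffix_order.refl fun_upd_other)
  then show ?case using M'(2,3) by (intro exI[of _ M']) simp
next
  case (ExZ x f)
  then obtain c where c: "sem (N(x := c)) f" "c \<in> \<int>" by auto
  have "\<exists>M'. (\<forall>y. (\<forall>q. suffix (0 # p) q \<longrightarrow> y \<noteq> Sk q) \<longrightarrow> M' y = (M(Sk p := c)) y) \<and>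
    int_ok (skol_int (0 # p) f) M' \<and> qsem M' (skol (0 # p) (\<sigma>(x := Sk p)) f)"
    by (rule ExZ.IH[OF c(1)])
      (use ExZ.prems in \<open>auto dest: suffix_ConsD simp: not_suffix_Cons_self\<close>)
  then obtain M' where M': "\<And>y. (\<forall>q. suffix (0 # p) q \<longrightarrow> y \<noteq> Sk q) \<Longrightarrow> M' y = (M(Sk p := c)) y"
    "int_ok (skol_int (0 # p) f) M'" "qsem M' (skol (0 # p) (\<sigma>(x := Sk p)) f)" by blast
  have "M' y = M y" if "\<forall>q. suffix p q \<longrightarrow> y \<noteq> Sk q" for y
    using M'(1)[of y] that by (metis suffix_ConsD suffix_order.refl fun_upd_other)
  moreover have "M' (Sk p) = c"
    using M'(1)[of "Sk p"] not_suffix_Cons_self[of 0 p] by (metis var.inject(4) fun_upd_same)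
  ultimately show ?case using M'(2,3) c(2) by (intro exI[of _ M']) (simp add: int_ok_def)
qed

lemma tf_step_skolem:
  assumes "transition_formula n F"
  shows "tf_step n F u v \<longleftrightarrow>
    (\<exists>M. pre_vec n M = u \<and> post_vec n M = v \<and> int_ok (int_syms F) M \<and> qsem M (skolem F))"
proof
  assume "tf_step n F u v"
  then obtain N where N: "pre_vec n N = u" "post_vec n N = v" "sem N F"
    by (auto simp: tf_step_def)
  \<comment> \<open>The default 0 is an integer, which gives the integrality premise for all Skolem
    constants.\<close>
  define M where "M y = (case y of Sk q \<Rightarrow> 0 | _ \<Rightarrow> N y)" for y
  have "\<exists>M'. (\<forall>y. (\<forall>q. suffix [] q \<longrightarrow> y \<noteq> Sk q) \<longrightarrow> M' y = M y) \<and>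
    int_ok (skol_int [] F) M' \<and> qsem M' (skol [] id F)"
    by (rule sem_imp_qsem_skol[OF N(3)])
      (use assms in \<open>auto simp: transition_formula_def M_def split: var.splits\<close>)
  then obtain M' where M': "\<And>y. (\<forall>q. y \<noteq> Sk q) \<Longrightarrow> M' y = M y"
    "int_ok (int_syms F) M'" "qsem M' (skolem F)"
    by (auto simp: int_syms_def skolem_def)
  have "pre_vec n M' = u" "post_vec n M' = v"
    using N(1,2) M'(1) by (auto simp: pre_vec_def post_vec_def M_def)
  with M'(2,3) show "\<exists>M. pre_vec n M = u \<and> post_vec n M = v \<and> int_ok (int_syms F) M \<and>
    qsem M (skolem F)" by blast
next
  assume "\<exists>M. pre_vec n M = u \<and> post_vec n M = v \<and> int_ok (int_syms F) M \<and> qsem M (skolem F)"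
  then show "tf_step n F u v"
    using qsem_skol_imp_sem[of _ "[]" id F]
    by (auto simp: tf_step_def int_syms_def skolem_def pre_vec_def post_vec_def)
qed

lemma int_syms_lra: "is_lra F \<Longrightarrow> int_syms F = {}"
proof -
  have "is_lra f \<Longrightarrow> skol_int p f = {}" for p f by (induction f arbitrary: p) auto
  then show "is_lra F \<Longrightarrow> int_syms F = {}" by (simp add: int_syms_def)
qed

lemma qsem_dnf: "qsem M f \<longleftrightarrow> (\<exists>C\<in>set (dnf f). cube_sem M C)"
proof (induction f)
  case (QAnd f g)
  then show ?case by (auto simp: cube_sem_def ball_Un)
qed (auto simp: cube_sem_def)

subsection \<open>Covering a convex set by finitely many affine sets\<close>

text \<open>A point of the segment between two interpretations. Skolem constants are mixed together
  with the states, so convexity is used for cubes over all symbols and never for their projections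
  to states.\<close>

definition mix :: "rat \<Rightarrow> ('a \<Rightarrow> rat) \<Rightarrow> ('a \<Rightarrow> rat) \<Rightarrow> 'a \<Rightarrow> rat" where
  "mix t M N = (\<lambda>x. (1 - t) * M x + t * N x)"

lemma lt_eval_mix:
  "lt_eval (mix t M N) s = (1 - t) * lt_eval M s + t * lt_eval N s"
  by (induction s) (simp_all add: mix_def, simp_all add: algebra_simps)

lemma convex_less:
  fixes t a b c d :: rat
  assumes "0 \<le> t" "t \<le> 1" "a < b" "c < d"
  shows "(1 - t) * a + t * c < (1 - t) * b + t * d"
proof (cases "t = 1")
  case False
  with assms have "(1 - t) * a < (1 - t) * b" by simp
  moreover have "t * c \<le> t * d" using assms by (simp add: mult_left_mono)
  ultimately show ?thesis by linarith
qed (use assms in simp)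

lemma cube_sem_mix:
  assumes "cube_sem M C" "cube_sem N C" "0 \<le> t" "t \<le> 1"
  shows "cube_sem (mix t M N) C"
proof -
  have "atom_sem (mix t M N) a" if "atom_sem M a" "atom_sem N a" for a
    using that assms(3,4) by (cases a) (auto simp: lt_eval_mix convex_less)
  then show ?thesis using assms by (auto simp: cube_sem_def)
qed

lemma affine_zero_twice:
  fixes t t' x y :: rat
  assumes "(1 - t) * x + t * y = 0" "(1 - t') * x + t' * y = 0" "t \<noteq> t'"
  shows "x = 0 \<and> y = 0"
proof -
  have "(t - t') * (y - x) = 0" using assms(1,2) by (simp add: algebra_simps)
  with assms have "y = x" by simp
  with assms(1) show ?thesis by (simp add: algebra_simps)
qed

text \<open>The premise on \<open>A i\<close> is affineness along lines: two points of a line inside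
  the set force the endpoints into it. In the induction, suppose that \<open>A i\<close> misses
  \<open>x\<close> in \<open>K\<close> and that the other sets all miss \<open>y\<close> in
  \<open>K\<close>. The segment from \<open>x\<close> to \<open>y\<close> has infinitely many
  rational points and finitely many sets cover it, so some set contains two of them, hence both
  \<open>x\<close> and \<open>y\<close>; no set does.\<close>

lemma convex_cover:
  fixes A :: "'i \<Rightarrow> ('a \<Rightarrow> rat) \<Rightarrow> bool"
  assumes "finite I"
    and "\<And>M N t. K M \<Longrightarrow> K N \<Longrightarrow> 0 \<le> t \<Longrightarrow> t \<le> 1 \<Longrightarrow> K (mix t M N)"
    and "\<And>i M N t t'. i \<in> I \<Longrightarrow> A i (mix t M N) \<Longrightarrow> A i (mix t' M N) \<Longrightarrow> t \<noteq> t' \<Longrightarrow> A i M \<and> A i N"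
    and "\<And>M. K M \<Longrightarrow> \<exists>i\<in>I. A i M" and "K M0"
  shows "\<exists>i\<in>I. \<forall>M. K M \<longrightarrow> A i M"
  using assms(1,3,4)
proof (induction I)
  case empty
  then show ?case using assms(5) by blast
next
  case (insert i I)
  show ?case
  proof (rule ccontr)
    assume neg: "\<not> ?case"
    then obtain x where x: "K x" "\<not> A i x" by auto
    have "\<not> (\<forall>M. K M \<longrightarrow> (\<exists>i\<in>I. A i M))"
    proof
      assume "\<forall>M. K M \<longrightarrow> (\<exists>i\<in>I. A i M)"
      with insert.IH insert.prems(1) have "\<exists>i\<in>I. \<forall>M. K M \<longrightarrow> A i M" by blast
      with neg show False by blast
    qed
    then obtain y where y: "K y" "\<And>j. j \<in> I \<Longrightarrow> \<not> A j y" by blast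
    have "\<forall>t\<in>{0..1}. \<exists>j\<in>insert i I. A j (mix t x y)"
      using assms(2)[OF x(1) y(1)] insert.prems(2) by auto
    then obtain f where f: "\<And>t. t \<in> {0..1} \<Longrightarrow> f t \<in> insert i I \<and> A (f t) (mix t x y)"
      by metis
    have "\<not> inj_on f {0..1}"
    proof
      assume "inj_on f {0..1}"
      moreover have "f ` {0..1} \<subseteq> insert i I" using f by blast
      then have "finite (f ` {0..1})" using insert.hyps(1) by (simp add: finite_subset)
      ultimately have "finite {0..1::rat}" by (rule finite_imageD[rotated])
      then show False by (simp add: infinite_Icc)
    qed
    then obtain t t' where t: "t \<in> {0..1}" "t' \<in> {0..1}" "f t = f t'" "t \<noteq> t'"
      by (auto simp: inj_on_def)
    have "A (f t) x \<and> A (f t) y"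
      by (rule insert.prems(1)[of _ t _ _ t']) (use f[OF t(1)] f[OF t(2)] t in auto)
    with x y f[OF t(1)] show False by auto
  qed
qed

subsection \<open>Bases of subspaces\<close>

lemma lincomb_carrier [simp]: "lincomb N c L \<in> carrier_vec N" "dim_vec (lincomb N c L) = N"
  by (auto simp: lincomb_def)

lemma lincomb_index [simp]: "j < N \<Longrightarrow> lincomb N c L $ j = (\<Sum>i<length L. c i * L ! i $ j)"
  by (simp add: lincomb_def)

lemma lincomb_snoc:
  "j < N \<Longrightarrow> lincomb N c (L @ [w]) $ j = lincomb N c L $ j + c (length L) * w $ j"
  by (auto simp: nth_append intro!: sum.cong)

text \<open>Echelon argument: the coordinates from \<open>k\<close> on vanish on \<open>W\<close>.
  The slice of \<open>W\<close> where one more coordinate vanishes has a basis by induction, and if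
  the slice is proper, a single vector with a nonzero entry there completes it.\<close>

lemma basis_exists_aux:
  assumes "W \<subseteq> carrier_vec N" "0\<^sub>v N \<in> W"
    and "\<And>x y q. x \<in> W \<Longrightarrow> y \<in> W \<Longrightarrow> x + q \<cdot>\<^sub>v y \<in> W"
    and "k \<le> N" "\<And>w j. w \<in> W \<Longrightarrow> k \<le> j \<Longrightarrow> j < N \<Longrightarrow> w $ j = 0"
  shows "\<exists>L. is_basis N W L"
  using assms
proof (induction k arbitrary: W)
  case 0
  have "w = 0\<^sub>v N" if "w \<in> W" for w
    using 0 that by (intro eq_vecI) auto
  then have "is_basis N W []" by (auto simp: is_basis_def lincomb_def zero_vec_def)
  then show ?case by blast
next
  case (Suc k)
  define W0 where "W0 = {w \<in> W. w $ k = 0}"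
  have "\<exists>L. is_basis N W0 L"
  proof (rule Suc.IH)
    show "x + q \<cdot>\<^sub>v y \<in> W0" if "x \<in> W0" "y \<in> W0" for x y q
      using that Suc.prems(1,3,4) by (auto simp: W0_def)
    show "w $ j = 0" if "w \<in> W0" "k \<le> j" "j < N" for w j
      using that Suc.prems(5)[of w j] by (cases "j = k") (auto simp: W0_def)
  qed (use Suc.prems in \<open>auto simp: W0_def\<close>)
  then obtain L where L: "is_basis N W0 L" by blast
  show ?case
  proof (cases "W0 = W")
    case True
    with L show ?thesis by blast
  next
    case False
    then obtain w where w: "w \<in> W" "w $ k \<noteq> 0" by (auto simp: W0_def)
    have wN: "w \<in> carrier_vec N" using w Suc.prems by auto
    have Lk: "lincomb N c L $ k = 0" for c
      using L Suc.prems(4) by (auto simp: is_basis_def W0_def subset_iff intro!: sum.neutral)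
    have "is_basis N W (L @ [w])"
      unfolding is_basis_def
    proof (intro conjI allI impI ballI)
      show "set (L @ [w]) \<subseteq> W" using L w by (auto simp: is_basis_def W0_def)
    next
      fix c i assume c: "lincomb N c (L @ [w]) = 0\<^sub>v N" and i: "i < length (L @ [w])"
      have z: "lincomb N c L $ j + c (length L) * w $ j = 0" if "j < N" for j
        using lincomb_snoc[OF that, of c L w] that unfolding c by simp
      from z[of k] Lk w Suc.prems(4) have c0: "c (length L) = 0" by simp
      with z have "lincomb N c L = 0\<^sub>v N" by (intro eq_vecI) simp_all
      with L have "\<forall>i<length L. c i = 0" by (auto simp: is_basis_def)
      with c0 i show "c i = 0" by (auto simp: less_Suc_eq)
    next
      fix x assume x: "x \<in> W"
      \<comment> \<open>The multiple of \<open>w\<close> that cancels coordinate \<open>k\<close> of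
        \<open>x\<close> and so moves \<open>x\<close> into the slice \<open>W0\<close>.\<close>
      define q where "q = x $ k / w $ k"
      have xN: "x \<in> carrier_vec N" using x Suc.prems by auto
      have "x + (- q) \<cdot>\<^sub>v w \<in> W0"
        using Suc.prems(3)[OF x w(1), of "- q"] xN wN w(2) Suc.prems(4) by (auto simp: W0_def q_def)
      with L obtain c where c: "x + (- q) \<cdot>\<^sub>v w = lincomb N c L" by (auto simp: is_basis_def)
      have "x = lincomb N (c(length L := q)) (L @ [w])"
      proof (rule eq_vecI)
        fix j assume "j < dim_vec (lincomb N (c(length L := q)) (L @ [w]))"
        then have j: "j < N" by simp
        have "x $ j - q * w $ j = (\<Sum>i<length L. c i * L ! i $ j)"
          using arg_cong[OF c, of "\<lambda>v. v $ j"] xN wN j by auto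
        then show "x $ j = lincomb N (c(length L := q)) (L @ [w]) $ j"
          using j by (simp add: lincomb_snoc del: lincomb_index) simp
      qed (use xN in auto)
      then show "\<exists>c. x = lincomb N c (L @ [w])" by blast
    qed
    then show ?thesis by blast
  qed
qed

lemma basis_exists:
  assumes "W \<subseteq> carrier_vec N" "0\<^sub>v N \<in> W"
    and "\<And>x y q. x \<in> W \<Longrightarrow> y \<in> W \<Longrightarrow> x + q \<cdot>\<^sub>v y \<in> W"
  obtains L where "is_basis N W L"
  using basis_exists_aux[OF assms, of N] by auto

section \<open>Coordinate formulas for matrix and pointwise products\<close>

lemma mult_mat_vec_index:
  "A \<in> carrier_mat e d \<Longrightarrow> v \<in> carrier_vec d \<Longrightarrow> i < e \<Longrightarrow>
   (A *\<^sub>v v) $ i = (\<Sum>j<d. A $$ (i, j) * v $ j)"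
  by (auto simp: scalar_prod_def atLeast0LessThan intro!: sum.cong)

lemma mult_mat_index:
  "A \<in> carrier_mat e d \<Longrightarrow> B \<in> carrier_mat d n \<Longrightarrow> i < e \<Longrightarrow> k < n \<Longrightarrow>
   (A * B) $$ (i, k) = (\<Sum>j<d. A $$ (i, j) * B $$ (j, k))"
  by (auto simp: scalar_prod_def atLeast0LessThan intro!: sum.cong)

lemma pmul_carrier [simp]:
  "u \<in> carrier_vec d \<Longrightarrow> pmul r u \<in> carrier_vec d" "dim_vec (pmul r u) = dim_vec u"
  by (auto simp: pmul_def)

lemma pmul_index [simp]: "i < dim_vec u \<Longrightarrow> pmul r u $ i = r $ i * u $ i"
  by (simp add: pmul_def)

lemma pre_post_carrier [simp]: "pre_vec n M \<in> carrier_vec n" "post_vec n M \<in> carrier_vec n"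
  by (auto simp: pre_vec_def post_vec_def)

subsection \<open>Coherent simulations\<close>

text \<open>One transformer of \<^term>\<open>V'\<close> simulates \<^term>\<open>(r, a)\<close> in all states at once; the condition
  on the nonzero entries says \<open>T diag(r) = diag(r') T\<close>.\<close>

definition uniform_sim ::
  "(rat vec \<times> rat vec) set \<Rightarrow> rat mat \<Rightarrow> (rat vec \<times> rat vec) set \<Rightarrow> bool" where
  "uniform_sim V T V' \<longleftrightarrow> (\<forall>(r, a) \<in> V. \<exists>(r', a') \<in> V'. T *\<^sub>v a = a' \<and>
     (\<forall>i < dim_row T. \<forall>j < dim_col T. T $$ (i, j) \<noteq> 0 \<longrightarrow> r $ j = r' $ i))"

lemma transformer_sim:
  assumes "T \<in> carrier_mat e d" "a \<in> carrier_vec d" "u \<in> carrier_vec d"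
    and "\<And>i j. i < e \<Longrightarrow> j < d \<Longrightarrow> T $$ (i, j) \<noteq> 0 \<Longrightarrow> r $ j = r' $ i"
  shows "T *\<^sub>v (pmul r u + a) = pmul r' (T *\<^sub>v u) + T *\<^sub>v a"
proof (rule eq_vecI)
  fix i assume "i < dim_vec (pmul r' (T *\<^sub>v u) + T *\<^sub>v a)"
  then have i: "i < e" using assms(1) by simp
  have "(T *\<^sub>v (pmul r u + a)) $ i = (\<Sum>j<d. T $$ (i, j) * (pmul r u + a) $ j)"
    by (rule mult_mat_vec_index) (use assms i in auto)
  also have "\<dots> = (\<Sum>j<d. r' $ i * (T $$ (i, j) * u $ j) + T $$ (i, j) * a $ j)"
  proof (rule sum.cong)
    fix j assume "j \<in> {..<d}"
    then show "T $$ (i, j) * (pmul r u + a) $ j = r' $ i * (T $$ (i, j) * u $ j) + T $$ (i, j) * a $ j"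
      using assms(2,3) assms(4)[OF i, of j] by (cases "T $$ (i, j) = 0") (auto simp: algebra_simps)
  qed simp
  also have "\<dots> = r' $ i * (T *\<^sub>v u) $ i + (T *\<^sub>v a) $ i"
    using mult_mat_vec_index[OF assms(1,3) i] mult_mat_vec_index[OF assms(1,2) i]
    by (simp add: sum.distrib sum_distrib_left)
  finally show "(T *\<^sub>v (pmul r u + a)) $ i = (pmul r' (T *\<^sub>v u) + T *\<^sub>v a) $ i"
    using assms(1) i by simp
qed (use assms in simp)

lemma uniform_simE:
  assumes "uniform_sim V T V'" "T \<in> carrier_mat e d" "is_vasr d V" "(r, a) \<in> V"
  obtains r' where "(r', T *\<^sub>v a) \<in> V'"
    and "\<And>i j. i < e \<Longrightarrow> j < d \<Longrightarrow> T $$ (i, j) \<noteq> 0 \<Longrightarrow> r $ j = r' $ i"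
    and "\<And>u. u \<in> carrier_vec d \<Longrightarrow> T *\<^sub>v (pmul r u + a) = pmul r' (T *\<^sub>v u) + T *\<^sub>v a"
proof -
  have a: "a \<in> carrier_vec d" using assms(3,4) by (auto simp: is_vasr_def)
  from assms(1,2,4) obtain r' where r': "(r', T *\<^sub>v a) \<in> V'"
    "\<And>i j. i < e \<Longrightarrow> j < d \<Longrightarrow> T $$ (i, j) \<noteq> 0 \<Longrightarrow> r $ j = r' $ i"
    unfolding uniform_sim_def by fastforce
  show thesis by (rule that[OF r']) (use transformer_sim[OF assms(2) a _ r'(2)] in auto)
qed

lemma uniform_sim_lin_sim:
  assumes "uniform_sim V T V'" "T \<in> carrier_mat e d" "is_vasr d V"
  shows "lin_sim (vasr_step d V) T (vasr_step e V')"
  unfolding lin_sim_def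
proof (intro allI impI)
  fix u v assume "vasr_step d V u v"
  then obtain r a where ra: "(r, a) \<in> V" "v = pmul r u + a" "u \<in> carrier_vec d" "v \<in> carrier_vec d"
    by (auto simp: vasr_step_def)
  from uniform_simE[OF assms ra(1)] obtain r' where "(r', T *\<^sub>v a) \<in> V'"
    "\<And>u. u \<in> carrier_vec d \<Longrightarrow> T *\<^sub>v (pmul r u + a) = pmul r' (T *\<^sub>v u) + T *\<^sub>v a" by metis
  then show "vasr_step e V' (T *\<^sub>v u) (T *\<^sub>v v)"
    using ra assms by (fastforce simp: vasr_step_def is_vasr_def intro: mult_mat_vec_carrier)
qed

text \<open>Used for both arguments of a join: whatever one argument covers is covered by the
  result, which gives coverage of \<open>F\<close> as well as progress.\<close>

lemma uniform_sim_gamma: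
  assumes "uniform_sim V T V'" "T \<in> carrier_mat e d" "is_vasr d V" "S \<in> carrier_mat d n"
    and "u \<in> carrier_vec n" "v \<in> carrier_vec n" "gamma S V u v"
  shows "gamma (T * S) V' u v"
proof -
  from assms(7) obtain r a where ra: "(r, a) \<in> V" "S *\<^sub>v v = pmul r (S *\<^sub>v u) + a"
    by (auto simp: gamma_def)
  from uniform_simE[OF assms(1-3) ra(1)] obtain r' where r': "(r', T *\<^sub>v a) \<in> V'"
    "\<And>u. u \<in> carrier_vec d \<Longrightarrow> T *\<^sub>v (pmul r u + a) = pmul r' (T *\<^sub>v u) + T *\<^sub>v a" by metis
  have "(T * S) *\<^sub>v v = T *\<^sub>v (S *\<^sub>v v)"
    by (rule assoc_mult_mat_vec[OF assms(2,4,6)])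
  also have "\<dots> = pmul r' (T *\<^sub>v (S *\<^sub>v u)) + T *\<^sub>v a"
    unfolding ra(2) using assms(4,5) by (intro r'(2)) simp
  also have "T *\<^sub>v (S *\<^sub>v u) = (T * S) *\<^sub>v u"
    by (rule assoc_mult_mat_vec[OF assms(2,4,5), symmetric])
  finally show ?thesis using r'(1) by (auto simp: gamma_def)
qed

subsection \<open>Normal abstractions\<close>

text \<open>The support of the row vector \<open>t\<close> lies in one coherence class, phrased
  without naming the class so that the zero vector is included. For empty \<open>V\<close> every
  vector is coherent.\<close>

definition coherent :: "nat \<Rightarrow> (rat vec \<times> rat vec) set \<Rightarrow> (nat \<Rightarrow> rat) \<Rightarrow> bool" where
  "coherent d V t \<longleftrightarrow> (\<forall>i<d. \<forall>j<d. t i \<noteq> 0 \<longrightarrow> t j \<noteq> 0 \<longrightarrow> (\<forall>(r, a) \<in> V. r $ i = r $ j))"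

text \<open>Quantifying over coherent combinations instead of over classes lets the rows of a
  simulation matrix be inserted for \<open>t\<close> directly. For empty \<open>V\<close> this is
  linear independence of all rows of \<open>S\<close>.\<close>

definition normal :: "rat mat \<Rightarrow> (rat vec \<times> rat vec) set \<Rightarrow> bool" where
  "normal S V \<longleftrightarrow> (\<forall>t. coherent (dim_row S) V t \<longrightarrow>
     (\<forall>k<dim_col S. (\<Sum>j<dim_row S. t j * S $$ (j, k)) = 0) \<longrightarrow> (\<forall>j<dim_row S. t j = 0))"

lemma normalD:
  assumes "normal S V" "S \<in> carrier_mat d n" "coherent d V t"
    "\<And>k. k < n \<Longrightarrow> (\<Sum>j<d. t j * S $$ (j, k)) = 0" "j < d"
  shows "t j = 0"
proof -
  from assms(2) have "dim_row S = d" "dim_col S = n" by auto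
  with assms(1,3) have "(\<forall>k<n. (\<Sum>j<d. t j * S $$ (j, k)) = 0) \<Longrightarrow> (\<forall>j<d. t j = 0)"
    unfolding normal_def by blast
  with assms(4,5) show ?thesis by blast
qed

lemma normal_one: "normal (1\<^sub>m n) V"
  unfolding normal_def
proof (intro allI impI)
  fix t j
  assume *: "\<forall>k<dim_col (1\<^sub>m n). (\<Sum>j<dim_row (1\<^sub>m n). t j * 1\<^sub>m n $$ (j, k)) = (0 :: rat)"
    and j: "j < dim_row (1\<^sub>m n)"
  have "(\<Sum>i<n. t i * 1\<^sub>m n $$ (i, j)) = (\<Sum>i<n. if i = j then t i else 0)"
    by (rule sum.cong) (use j in auto)
  with * j show "t j = 0" by simp
qed

subsection \<open>Abstraction of a single cube\<close>

lemma pair_vec_index: "s \<in> carrier_vec n \<Longrightarrow> k < n \<Longrightarrow> pair_vec s b $ k = s $ k"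
  "s \<in> carrier_vec n \<Longrightarrow> pair_vec s b $ n = b"
  by (auto simp: pair_vec_def)

lemma dim_pair_vec [simp]: "dim_vec (pair_vec s b) = Suc (dim_vec s)"
  by (simp add: pair_vec_def)

lemma pair_vec_carrier [simp]: "s \<in> carrier_vec n \<Longrightarrow> pair_vec s b \<in> carrier_vec (Suc n)"
  by (rule carrier_vecI) simp

lemma pair_vec_inject:
  assumes "s \<in> carrier_vec n" "s' \<in> carrier_vec n"
  shows "pair_vec s b = pair_vec s' b' \<longleftrightarrow> s = s' \<and> b = b'"
proof
  assume eq: "pair_vec s b = pair_vec s' b'"
  have "s $ k = s' $ k" if "k < n" for k
    using arg_cong[OF eq, of "\<lambda>v. v $ k"] pair_vec_index(1)[OF assms(1) that]
      pair_vec_index(1)[OF assms(2) that] by simp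
  moreover have "b = b'"
    using arg_cong[OF eq, of "\<lambda>v. v $ n"] pair_vec_index(2)[OF assms(1)]
      pair_vec_index(2)[OF assms(2)] by simp
  ultimately show "s = s' \<and> b = b'" using assms by auto
qed simp

lemma pair_vec_eqI:
  assumes "w \<in> carrier_vec (Suc n)" "s \<in> carrier_vec n" "\<And>k. k < n \<Longrightarrow> w $ k = s $ k" "w $ n = b"
  shows "w = pair_vec s b"
proof (rule eq_vecI)
  fix k assume "k < dim_vec (pair_vec s b)"
  then have "k < n \<or> k = n" using assms(2) by auto
  then show "w $ k = pair_vec s b $ k" using assms(3,4) pair_vec_index[OF assms(2)] by auto
qed (use assms(1,2) in simp)

definition pair_rows :: "rat mat \<Rightarrow> rat vec \<Rightarrow> nat \<Rightarrow> nat \<Rightarrow> rat vec list" where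
  "pair_rows S a x y = map (\<lambda>i. pair_vec (row S i) (a $ i)) [x..<y]"

lemma pair_rows_mem:
  "is_basis N W (pair_rows S a x y) \<Longrightarrow> i \<in> {x..<y} \<Longrightarrow> pair_vec (row S i) (a $ i) \<in> W"
  unfolding is_basis_def pair_rows_def by (rule subsetD, erule conjunct1) simp

lemma sum_shift: "(\<Sum>i<y - x. f (x + i)) = (\<Sum>i\<in>{x..<y}. f i)" for x y :: nat
  by (rule sum.reindex_bij_witness[of _ "\<lambda>i. i - x" "\<lambda>i. x + i"]) auto

lemma lincomb_pair_rows:
  assumes "S \<in> carrier_mat d n" "y \<le> d"
  shows "lincomb (Suc n) c (pair_rows S a x y) =
    pair_vec (vec n (\<lambda>k. \<Sum>i\<in>{x..<y}. c (i - x) * S $$ (i, k))) (\<Sum>i\<in>{x..<y}. c (i - x) * a $ i)"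
proof (rule pair_vec_eqI)
  have row: "row S i \<in> carrier_vec n" for i using assms by auto
  show "lincomb (Suc n) c (pair_rows S a x y) $ k = vec n (\<lambda>k. \<Sum>i\<in>{x..<y}. c (i - x) * S $$ (i, k)) $ k"
    if "k < n" for k
  proof -
    have "lincomb (Suc n) c (pair_rows S a x y) $ k = (\<Sum>i<y - x. c (x + i - x) * S $$ (x + i, k))"
      using that assms by (auto simp: pair_rows_def pair_vec_index[OF row] intro!: sum.cong)
    also have "\<dots> = (\<Sum>i\<in>{x..<y}. c (i - x) * S $$ (i, k))" by (rule sum_shift)
    finally show ?thesis using that by simp
  qed
  have "lincomb (Suc n) c (pair_rows S a x y) $ n = (\<Sum>i<y - x. c (x + i - x) * a $ (x + i))"
    by (auto simp: pair_rows_def pair_vec_index[OF row] intro!: sum.cong)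
  then show "lincomb (Suc n) c (pair_rows S a x y) $ n = (\<Sum>i\<in>{x..<y}. c (i - x) * a $ i)"
    by (simp only: sum_shift[where f = "\<lambda>i. c (i - x) * a $ i"])
qed auto

text \<open>A basis of \<open>Res\<close> or \<open>Inc\<close> makes the pairs of row and offset
  independent, while normality asks for independence of the rows alone. A point \<open>w\<close> at
  which every row takes its offset as value closes the gap: a relation among the rows, evaluated at
  \<open>w\<close>, is also a relation among the offsets. For reset rows \<open>w\<close> is the
  post-state of a model, for increment rows it is post-state minus pre-state.\<close>

lemma pair_rows_independent:
  assumes "is_basis (Suc n) W (pair_rows S a x y)" "S \<in> carrier_mat d n" "y \<le> d"
    and w: "w \<in> carrier_vec n" "\<And>i. i \<in> {x..<y} \<Longrightarrow> row S i \<bullet> w = a $ i"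
    and t: "\<And>k. k < n \<Longrightarrow> (\<Sum>i\<in>{x..<y}. t i * S $$ (i, k)) = 0" and i: "i \<in> {x..<y}"
  shows "t i = 0"
proof -
  define c where "c j = t (x + j)" for j
  have S: "(\<Sum>i\<in>{x..<y}. c (i - x) * S $$ (i, k)) = 0" if "k < n" for k
    using t[OF that] by (simp add: c_def)
  have "(\<Sum>i\<in>{x..<y}. c (i - x) * a $ i) = (\<Sum>i\<in>{x..<y}. \<Sum>k<n. c (i - x) * S $$ (i, k) * w $ k)"
  proof (rule sum.cong)
    fix i assume i: "i \<in> {x..<y}"
    have "a $ i = row S i \<bullet> w" using w(2)[OF i] by simp
    also have "\<dots> = (\<Sum>k<n. S $$ (i, k) * w $ k)"
      using w(1) assms(2,3) i by (auto simp: scalar_prod_def atLeast0LessThan intro!: sum.cong)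
    finally have "a $ i = (\<Sum>k<n. S $$ (i, k) * w $ k)" .
    then show "c (i - x) * a $ i = (\<Sum>k<n. c (i - x) * S $$ (i, k) * w $ k)"
      by (simp add: sum_distrib_left mult.assoc)
  qed simp
  also have "\<dots> = (\<Sum>k<n. (\<Sum>i\<in>{x..<y}. c (i - x) * S $$ (i, k)) * w $ k)"
    by (subst sum.swap) (simp add: sum_distrib_right)
  finally have "(\<Sum>i\<in>{x..<y}. c (i - x) * a $ i) = 0" using S by simp
  then have "lincomb (Suc n) c (pair_rows S a x y) = 0\<^sub>v (Suc n)"
    unfolding lincomb_pair_rows[OF assms(2,3)] using S
    by (intro pair_vec_eqI[symmetric]) auto
  with assms(1) have "\<forall>i<y - x. c i = 0" by (auto simp: is_basis_def pair_rows_def)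
  then have "c (i - x) = 0" using i by (auto intro: diff_less_mono)
  then show ?thesis using i by (simp add: c_def)
qed

lemma pair_rows_span:
  assumes "is_basis (Suc n) W (pair_rows S a x y)" "S \<in> carrier_mat d n" "y \<le> d"
    and "s \<in> carrier_vec n" "pair_vec s b \<in> W"
  obtains t where "\<And>j. t j \<noteq> 0 \<Longrightarrow> j \<in> {x..<y}"
    and "\<And>k. k < n \<Longrightarrow> s $ k = (\<Sum>j<d. t j * S $$ (j, k))" and "b = (\<Sum>j<d. t j * a $ j)"
proof -
  from assms(1,5) obtain c where "pair_vec s b = lincomb (Suc n) c (pair_rows S a x y)"
    by (auto simp: is_basis_def)
  then have c: "s = vec n (\<lambda>k. \<Sum>i\<in>{x..<y}. c (i - x) * S $$ (i, k))"
    "b = (\<Sum>i\<in>{x..<y}. c (i - x) * a $ i)"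
    unfolding lincomb_pair_rows[OF assms(2,3)] by (simp_all add: pair_vec_inject[OF assms(4) vec_carrier])
  define t where "t j = (if j \<in> {x..<y} then c (j - x) else 0)" for j
  have ext: "(\<Sum>i\<in>{x..<y}. c (i - x) * f i) = (\<Sum>j<d. t j * f j)" for f
    using assms(3) by (intro sum.mono_neutral_cong_left) (auto simp: t_def)
  show thesis
  proof (rule that[of t])
    show "s $ k = (\<Sum>j<d. t j * S $$ (j, k))" if "k < n" for k
      using that c(1) ext[of "\<lambda>j. S $$ (j, k)"] by simp
    show "b = (\<Sum>j<d. t j * a $ j)" using c(2) ext[of "\<lambda>j. a $ j"] by simp
  qed (auto simp: t_def split: if_splits)
qed

lemma Res_iff:
  "s \<in> carrier_vec n \<Longrightarrow> pair_vec s b \<in> Res n Z C \<longleftrightarrow>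
    (\<forall>M. int_ok Z M \<longrightarrow> cube_sem M C \<longrightarrow> s \<bullet> post_vec n M = b)"
  unfolding Res_def mem_Collect_eq using pair_vec_inject[of s n _ b] by metis

lemma Inc_iff:
  "s \<in> carrier_vec n \<Longrightarrow> pair_vec s b \<in> Inc n Z C \<longleftrightarrow>
    (\<forall>M. int_ok Z M \<longrightarrow> cube_sem M C \<longrightarrow> s \<bullet> post_vec n M = s \<bullet> pre_vec n M + b)"
  unfolding Inc_def mem_Collect_eq using pair_vec_inject[of s n _ b] by metis

lemma pair_vec_add_smult:
  assumes "s \<in> carrier_vec n" "s' \<in> carrier_vec n"
  shows "pair_vec s b + q \<cdot>\<^sub>v pair_vec s' b' = pair_vec (s + q \<cdot>\<^sub>v s') (b + q * b')"
  by (rule pair_vec_eqI[of _ n]) (use assms in \<open>auto simp: pair_vec_index\<close>)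

lemma pair_vec_zero: "0\<^sub>v (Suc n) = pair_vec (0\<^sub>v n) 0"
  by (rule pair_vec_eqI[of _ n]) auto

lemma Res_carrier: "Res n Z C \<subseteq> carrier_vec (Suc n)" by (auto simp: Res_def)

lemma Inc_carrier: "Inc n Z C \<subseteq> carrier_vec (Suc n)" by (auto simp: Inc_def)

lemma Res_basis: obtains L where "is_basis (Suc n) (Res n Z C) L"
proof (rule basis_exists[OF Res_carrier])
  show "0\<^sub>v (Suc n) \<in> Res n Z C" unfolding pair_vec_zero by (simp add: Res_iff)
  fix x y q assume "x \<in> Res n Z C" "y \<in> Res n Z C"
  then obtain s b s' b' where *: "x = pair_vec s b" "y = pair_vec s' b'"
    "s \<in> carrier_vec n" "s' \<in> carrier_vec n" by (auto simp: Res_def)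
  with \<open>x \<in> _\<close> \<open>y \<in> _\<close> show "x + q \<cdot>\<^sub>v y \<in> Res n Z C"
    by (auto simp: Res_iff pair_vec_add_smult add_scalar_prod_distrib[of _ n])
qed (use that in auto)

lemma Inc_basis: obtains L where "is_basis (Suc n) (Inc n Z C) L"
proof (rule basis_exists[OF Inc_carrier])
  show "0\<^sub>v (Suc n) \<in> Inc n Z C" unfolding pair_vec_zero by (simp add: Inc_iff)
  fix x y q assume "x \<in> Inc n Z C" "y \<in> Inc n Z C"
  then obtain s b s' b' where *: "x = pair_vec s b" "y = pair_vec s' b'"
    "s \<in> carrier_vec n" "s' \<in> carrier_vec n" by (auto simp: Inc_def)
  with \<open>x \<in> _\<close> \<open>y \<in> _\<close> show "x + q \<cdot>\<^sub>v y \<in> Inc n Z C"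
    by (auto simp: Inc_iff pair_vec_add_smult add_scalar_prod_distrib[of _ n] algebra_simps)
qed (use that in auto)

lemma alpha_hat_exists: "\<exists>A. alpha_hat n Z C A"
proof -
  obtain L1 where L1: "is_basis (Suc n) (Res n Z C) L1" by (rule Res_basis)
  obtain L2 where L2: "is_basis (Suc n) (Inc n Z C) L2" by (rule Inc_basis)
  define L where "L = L1 @ L2"
  define m d where "m = length L1" and "d = length L"
  define S where "S = mat d n (\<lambda>(i, k). L ! i $ k)"
  define a where "a = vec d (\<lambda>i. L ! i $ n)"
  have "set L \<subseteq> carrier_vec (Suc n)"
    using L1 L2 Res_carrier[of n Z C] Inc_carrier[of n Z C] by (auto simp: L_def is_basis_def)
  then have Ln: "L ! i \<in> carrier_vec (Suc n)" if "i < d" for i using that by (auto simp: d_def)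
  have L_row: "pair_vec (row S i) (a $ i) = L ! i" if "i < d" for i
    using that Ln[OF that] by (intro pair_vec_eqI[symmetric]) (auto simp: S_def a_def)
  have "map (\<lambda>i. pair_vec (row S i) (a $ i)) [0..<m] = L1"
    by (rule nth_equalityI) (auto simp: L_row L_def m_def d_def nth_append)
  moreover have "map (\<lambda>i. pair_vec (row S i) (a $ i)) [m..<d] = L2"
    by (rule nth_equalityI) (auto simp: L_row L_def m_def d_def)
  moreover have "S \<in> carrier_mat d n" "a \<in> carrier_vec d" "m \<le> d"
    by (auto simp: S_def a_def m_def d_def L_def)
  ultimately show ?thesis unfolding alpha_hat_def Suc_eq_plus1[symmetric] using L1 L2 by metis
qed

text \<open>The model \<open>M0\<close> is what yields normality. The last clause is the universal
  property of \<alpha>-hat. If one transformer \<open>(r', a')\<close> describes the whole cube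
  through \<open>S'\<close>, then row \<open>i\<close> of \<open>S'\<close> with its offset lies in
  \<open>Res\<close> or in \<open>Inc\<close>, according to whether \<open>r'\<close> has 0 or 1 at
  \<open>i\<close>. Its coordinates in the chosen basis become row \<open>i\<close> of
  \<open>T\<close>; being supported in the matching block, they satisfy the condition on reset
  factors in \<open>uniform_sim\<close>.\<close>

lemma alpha_hatE:
  assumes "alpha_hat n Z C (S, V)" "int_ok Z M0" "cube_sem M0 C"
  obtains d r a where "S \<in> carrier_mat d n" "V = {(r, a)}" "is_vasr d V" "normal S V"
    and "\<And>M. int_ok Z M \<Longrightarrow> cube_sem M C \<Longrightarrow>
      S *\<^sub>v post_vec n M = pmul r (S *\<^sub>v pre_vec n M) + a"
    and "\<And>S' V' e r' a'. S' \<in> carrier_mat e n \<Longrightarrow> is_vasr e V' \<Longrightarrow> (r', a') \<in> V' \<Longrightarrow>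
      (\<And>M. int_ok Z M \<Longrightarrow> cube_sem M C \<Longrightarrow>
        S' *\<^sub>v post_vec n M = pmul r' (S' *\<^sub>v pre_vec n M) + a') \<Longrightarrow>
      \<exists>T\<in>carrier_mat e d. uniform_sim V T V' \<and> T * S = S'"
proof -
  from assms(1) obtain m d a where S: "S \<in> carrier_mat d n" and a: "a \<in> carrier_vec d" and m: "m \<le> d"
    and R: "is_basis (Suc n) (Res n Z C) (pair_rows S a 0 m)"
    and I: "is_basis (Suc n) (Inc n Z C) (pair_rows S a m d)"
    and V: "V = {(vec d (\<lambda>i. if i < m then 0 else 1), a)}"
    unfolding alpha_hat_def pair_rows_def Suc_eq_plus1 by auto
  define r :: "rat vec" where "r = vec d (\<lambda>i. if i < m then 0 else 1)"
  have r: "r $ i = (if i < m then 0 else 1)" if "i < d" for i using that by (simp add: r_def)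
  have row: "row S i \<in> carrier_vec n" for i using S by auto
  have res: "row S i \<bullet> post_vec n M = a $ i" if "i < m" "int_ok Z M" "cube_sem M C" for i M
    using pair_rows_mem[OF R, of i] that by (simp add: Res_iff[OF row])
  have inc: "row S i \<bullet> post_vec n M = row S i \<bullet> pre_vec n M + a $ i"
    if "m \<le> i" "i < d" "int_ok Z M" "cube_sem M C" for i M
    using pair_rows_mem[OF I, of i] that by (simp add: Inc_iff[OF row])
  show thesis
  proof (rule that[of d r a])
    show "S \<in> carrier_mat d n" by (rule S)
    show V': "V = {(r, a)}" by (simp add: V r_def)
    show vasr: "is_vasr d V" using a r unfolding V' is_vasr_def by (auto simp: r_def)
    show "normal S V"
      unfolding normal_def
    proof (intro allI impI)
      fix t j
      assume coh: "coherent (dim_row S) V t" and j: "j < dim_row S"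
        and z: "\<forall>k<dim_col S. (\<Sum>j<dim_row S. t j * S $$ (j, k)) = 0"
      \<comment> \<open>\<open>r\<close> is 0 on the first \<open>m\<close> dimensions and 1 on the
        others, so a coherent \<open>t\<close> is supported in only one of the two bases.\<close>
      have coh': "(i < m) = (i' < m)" if "i < d" "i' < d" "t i \<noteq> 0" "t i' \<noteq> 0" for i i'
        using coh that S r by (auto simp: coherent_def V' split: if_splits)
      show "t j = 0"
      proof (rule ccontr)
        assume tj: "t j \<noteq> 0"
        show False
        proof (cases "j < m")
          case True
          then have t0: "t i = 0" if "i < d" "\<not> i < m" for i
            using coh'[of j i] tj j S that by auto
          have z0: "(\<Sum>i\<in>{0..<m}. t i * S $$ (i, k)) = 0" if "k < n" for k
          proof -
            have "(\<Sum>i\<in>{0..<m}. t i * S $$ (i, k)) = (\<Sum>i<d. t i * S $$ (i, k))"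
              using m t0 by (intro sum.mono_neutral_left) auto
            then show ?thesis using z that S by simp
          qed
          have "t j = 0"
            by (rule pair_rows_independent[OF R S m, of "post_vec n M0"]) (use z0 res assms True in auto)
          with tj show False by simp
        next
          case False
          then have t0: "t i = 0" if "i < m" for i
            using coh'[of j i] tj j m S that by auto
          have "(\<Sum>i\<in>{m..<d}. t i * S $$ (i, k)) = 0" if "k < n" for k
          proof -
            have "(\<Sum>i\<in>{m..<d}. t i * S $$ (i, k)) = (\<Sum>i<d. t i * S $$ (i, k))"
              using m t0 by (intro sum.mono_neutral_left) auto
            then show ?thesis using z that S by simp
          qed
          moreover have "row S i \<bullet> (post_vec n M0 - pre_vec n M0) = a $ i" if "i \<in> {m..<d}" for i
            using inc[of i M0] that assms(2,3) by (simp add: scalar_prod_minus_distrib[OF row])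
          ultimately have "t j = 0"
            using pair_rows_independent[OF I S order_refl, of "post_vec n M0 - pre_vec n M0" t j]
              False j S by auto
          with tj show False by simp
        qed
      qed
    qed
    show "S *\<^sub>v post_vec n M = pmul r (S *\<^sub>v pre_vec n M) + a" if "int_ok Z M" "cube_sem M C" for M
    proof (rule eq_vecI)
      fix i assume "i < dim_vec (pmul r (S *\<^sub>v pre_vec n M) + a)"
      then have i: "i < d" using a by simp
      then have "row S i \<bullet> post_vec n M = r $ i * (row S i \<bullet> pre_vec n M) + a $ i"
        using r[OF i] res[OF _ that] inc[OF _ i that] by (cases "i < m") simp_all
      then show "(S *\<^sub>v post_vec n M) $ i = (pmul r (S *\<^sub>v pre_vec n M) + a) $ i"
        using a S i by simp
    qed (use S a in auto)
    show "\<exists>T\<in>carrier_mat e d. uniform_sim V T W \<and> T * S = S'"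
      if S': "S' \<in> carrier_mat e n" and W: "is_vasr e W" "(r', a') \<in> W"
        and eq: "\<And>M. int_ok Z M \<Longrightarrow> cube_sem M C \<Longrightarrow>
          S' *\<^sub>v post_vec n M = pmul r' (S' *\<^sub>v pre_vec n M) + a'"
      for S' W e r' a'
    proof -
      have a': "a' \<in> carrier_vec e" and r': "\<And>i. i < e \<Longrightarrow> r' $ i = 0 \<or> r' $ i = 1"
        using W by (auto simp: is_vasr_def)
      have row': "row S' i \<in> carrier_vec n" for i using S' by auto
      have eq_row: "row S' i \<bullet> post_vec n M = r' $ i * (row S' i \<bullet> pre_vec n M) + a' $ i"
        if "i < e" "int_ok Z M" "cube_sem M C" for i M
        using arg_cong[OF eq[OF that(2,3)], of "\<lambda>v. v $ i"] that(1) S' a' by simp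
      have "\<exists>t. (\<forall>j<d. t j \<noteq> 0 \<longrightarrow> r $ j = r' $ i) \<and>
        (\<forall>k<n. S' $$ (i, k) = (\<Sum>j<d. t j * S $$ (j, k))) \<and> a' $ i = (\<Sum>j<d. t j * a $ j)"
        if i: "i < e" for i
      proof (cases "r' $ i = 0")
        case True
        then have "pair_vec (row S' i) (a' $ i) \<in> Res n Z C"
          using eq_row[OF i] by (simp add: Res_iff[OF row'])
        from pair_rows_span[OF R S m row' this] obtain t where "\<And>j. t j \<noteq> 0 \<Longrightarrow> j \<in> {0..<m}"
          "\<And>k. k < n \<Longrightarrow> row S' i $ k = (\<Sum>j<d. t j * S $$ (j, k))" "a' $ i = (\<Sum>j<d. t j * a $ j)"
          by metis
        then show ?thesis using True r S' i by (intro exI[of _ t]) fastforce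
      next
        case False
        with r' i have r1: "r' $ i = 1" by blast
        then have "pair_vec (row S' i) (a' $ i) \<in> Inc n Z C"
          using eq_row[OF i] by (simp add: Inc_iff[OF row'])
        from pair_rows_span[OF I S order_refl row' this] obtain t where "\<And>j. t j \<noteq> 0 \<Longrightarrow> j \<in> {m..<d}"
          "\<And>k. k < n \<Longrightarrow> row S' i $ k = (\<Sum>j<d. t j * S $$ (j, k))" "a' $ i = (\<Sum>j<d. t j * a $ j)"
          by metis
        then show ?thesis using r1 r S' i by (intro exI[of _ t]) fastforce
      qed
      then have "\<forall>i. \<exists>t. i < e \<longrightarrow> (\<forall>j<d. t j \<noteq> 0 \<longrightarrow> r $ j = r' $ i) \<and>
        (\<forall>k<n. S' $$ (i, k) = (\<Sum>j<d. t j * S $$ (j, k))) \<and> a' $ i = (\<Sum>j<d. t j * a $ j)"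
        by blast
      from choice[OF this] obtain t where t: "\<And>i j. i < e \<Longrightarrow> j < d \<Longrightarrow> t i j \<noteq> 0 \<Longrightarrow> r $ j = r' $ i"
        "\<And>i k. i < e \<Longrightarrow> k < n \<Longrightarrow> S' $$ (i, k) = (\<Sum>j<d. t i j * S $$ (j, k))"
        "\<And>i. i < e \<Longrightarrow> a' $ i = (\<Sum>j<d. t i j * a $ j)" by blast
      define T where "T = mat e d (\<lambda>(i, j). t i j)"
      have T: "T \<in> carrier_mat e d" "\<And>i j. i < e \<Longrightarrow> j < d \<Longrightarrow> T $$ (i, j) = t i j"
        by (auto simp: T_def)
      have "T * S = S'"
        using T S S' t(2) by (intro eq_matI) (auto simp: mult_mat_index[OF T(1) S] simp del: index_mult_mat(1))
      moreover have "T *\<^sub>v a = a'"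
        using T a a' t(3) by (intro eq_vecI) (auto simp: mult_mat_vec_index[OF T(1) a] simp del: index_mult_mat_vec)
      then have "uniform_sim V T W"
        using W(2) t(1) T by (auto simp: uniform_sim_def V' intro!: bexI[of _ "(r', a')"])
      ultimately show ?thesis using T(1) by blast
    qed
  qed
qed

lemma mult_mat_vec_post_mix:
  assumes "S \<in> carrier_mat e n" "i < e"
  shows "(S *\<^sub>v post_vec n (mix t M N)) $ i =
      (1 - t) * (S *\<^sub>v post_vec n M) $ i + t * (S *\<^sub>v post_vec n N) $ i"
    and "(S *\<^sub>v pre_vec n (mix t M N)) $ i =
      (1 - t) * (S *\<^sub>v pre_vec n M) $ i + t * (S *\<^sub>v pre_vec n N) $ i"
proof -
  note index = mult_mat_vec_index[OF assms(1) pre_post_carrier(1) assms(2)]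
    mult_mat_vec_index[OF assms(1) pre_post_carrier(2) assms(2)]
  show "(S *\<^sub>v post_vec n (mix t M N)) $ i =
      (1 - t) * (S *\<^sub>v post_vec n M) $ i + t * (S *\<^sub>v post_vec n N) $ i"
    unfolding index sum_distrib_left sum.distrib[symmetric]
    by (rule sum.cong) (simp_all add: post_vec_def mix_def algebra_simps)
  show "(S *\<^sub>v pre_vec n (mix t M N)) $ i =
      (1 - t) * (S *\<^sub>v pre_vec n M) $ i + t * (S *\<^sub>v pre_vec n N) $ i"
    unfolding index sum_distrib_left sum.distrib[symmetric]
    by (rule sum.cong) (simp_all add: pre_vec_def mix_def algebra_simps)
qed

text \<open>A cube without integrality constraints is convex, so one transformer covers all of it.\<close>

lemma cube_single_transformer:
  assumes "S \<in> carrier_mat e n" "is_vasr e V" "cube_sem M0 C"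
    and cover: "\<And>M. cube_sem M C \<Longrightarrow> gamma S V (pre_vec n M) (post_vec n M)"
  obtains r a where "(r, a) \<in> V"
    and "\<And>M. cube_sem M C \<Longrightarrow> S *\<^sub>v post_vec n M = pmul r (S *\<^sub>v pre_vec n M) + a"
proof -
  define A where "A p M \<longleftrightarrow> S *\<^sub>v post_vec n M = pmul (fst p) (S *\<^sub>v pre_vec n M) + snd p" for p M
  \<comment> \<open>The defect of transformer \<open>p\<close> in row \<open>i\<close>. It is affine
    along \<open>mix\<close>, so its vanishing at two points of a line forces it to vanish at the
    endpoints.\<close>
  define g where "g p i M = (S *\<^sub>v post_vec n M) $ i - (fst p $ i * (S *\<^sub>v pre_vec n M) $ i + snd p $ i)"
    for p :: "rat vec \<times> rat vec" and i M
  have A_iff: "A p M \<longleftrightarrow> (\<forall>i<e. g p i M = 0)" if "p \<in> V" for p M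
  proof -
    have "snd p \<in> carrier_vec e" using assms(2) that by (auto simp: is_vasr_def)
    then show ?thesis using assms(1) unfolding A_def g_def vec_eq_iff by auto
  qed
  have g_mix: "g p i (mix t M N) = (1 - t) * g p i M + t * g p i N" if "i < e" for p i t M N
    unfolding g_def mult_mat_vec_post_mix[OF assms(1) that] by (simp add: algebra_simps)
  have "\<exists>p\<in>V. \<forall>M. cube_sem M C \<longrightarrow> A p M"
  proof (rule convex_cover)
    show "finite V" using assms(2) by (simp add: is_vasr_def)
    show "A p M \<and> A p N" if "p \<in> V" "A p (mix t M N)" "A p (mix t' M N)" "t \<noteq> t'" for p M N t t'
      using that affine_zero_twice[of t "g p _ M" "g p _ N" t'] by (auto simp: A_iff g_mix)
    show "\<exists>p\<in>V. A p M" if "cube_sem M C" for M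
      using cover[OF that] by (force simp: gamma_def A_def)
  qed (use cube_sem_mix assms(3) in auto)
  then show thesis using that by (auto simp: A_def)
qed

subsection \<open>Coherence classes\<close>

lemma coherence_class_subset: "C \<in> coherence_classes d V \<Longrightarrow> C \<subseteq> {..<d}"
  by (auto simp: coherence_classes_def)

lemma coherence_class_cover: "i < d \<Longrightarrow> \<exists>C\<in>coherence_classes d V. i \<in> C"
  unfolding coherence_classes_def
  by (rule bexI[of _ "{j. j < d \<and> (\<forall>(r, a)\<in>V. r $ j = r $ i)}"]) blast+

lemma coherence_class_mem_iff:
  assumes "C \<in> coherence_classes d V" "i \<in> C"
  shows "j \<in> C \<longleftrightarrow> j < d \<and> (\<forall>(r, a)\<in>V. r $ i = r $ j)"
proof -
  from assms obtain l where "C = {j. j < d \<and> (\<forall>(r, a)\<in>V. r $ j = r $ l)}"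
    by (auto simp: coherence_classes_def)
  with assms(2) show ?thesis by fastforce
qed

lemma coherence_class_eq:
  assumes "C \<in> coherence_classes d V" "i \<in> C" "j \<in> C" "(r, a) \<in> V"
  shows "r $ i = r $ j"
  using coherence_class_mem_iff[OF assms(1,2), of j] assms(3,4) by blast

lemma coherence_class_unique:
  assumes "C \<in> coherence_classes d V" "C' \<in> coherence_classes d V" "i \<in> C" "j \<in> C'"
    and "\<And>r a. (r, a) \<in> V \<Longrightarrow> r $ i = r $ j"
  shows "C = C'"
proof -
  have "l \<in> C \<longleftrightarrow> l \<in> C'" for l
    using coherence_class_mem_iff[OF assms(1,3), of l] coherence_class_mem_iff[OF assms(2,4), of l] assms(5)
    by fastforce
  then show ?thesis by blast
qed

lemma coherent_if_class:
  assumes "C \<in> coherence_classes d V" "\<And>j. j < d \<Longrightarrow> t j \<noteq> 0 \<Longrightarrow> j \<in> C"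
  shows "coherent d V t"
  unfolding coherent_def
proof (intro allI impI ballI)
  fix i j x assume "i < d" "j < d" "t i \<noteq> 0" "t j \<noteq> 0" and x: "x \<in> V"
  then have ij: "i \<in> C" "j \<in> C" using assms(2) by blast+
  obtain r a where "x = (r, a)" by (cases x)
  then show "case x of (r, a) \<Rightarrow> r $ i = r $ j"
    using coherence_class_eq[OF assms(1) ij, of r a] x by simp
qed

lemma coherent_class:
  assumes "coherent d V t" "i < d" "t i \<noteq> 0"
  obtains C where "C \<in> coherence_classes d V" "i \<in> C" "\<And>j. j < d \<Longrightarrow> t j \<noteq> 0 \<Longrightarrow> j \<in> C"
proof -
  obtain C where C: "C \<in> coherence_classes d V" "i \<in> C"
    using coherence_class_cover[OF assms(2)] by blast
  have "j \<in> C" if "j < d" "t j \<noteq> 0" for j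
    using assms that unfolding coherence_class_mem_iff[OF C] coherent_def by blast
  with C show thesis using that by blast
qed

lemma finite_coherence_classes: "finite (coherence_classes d V)"
  by (simp add: coherence_classes_def setcompr_eq_image)

text \<open>For each transformer the reset factors on the support of row \<open>i\<close> all equal
  one target factor. That factor may differ between transformers, which coherence permits.\<close>

lemma uniform_sim_coherent:
  assumes "uniform_sim V T V'" "T \<in> carrier_mat e d" "i < e"
  shows "coherent d V (\<lambda>j. T $$ (i, j))"
  unfolding coherent_def
proof (intro allI impI ballI)
  fix j l x assume *: "j < d" "l < d" "T $$ (i, j) \<noteq> 0" "T $$ (i, l) \<noteq> 0" "x \<in> V"
  obtain r a where x: "x = (r, a)" by (cases x)
  from assms(1) *(5) x obtain r' where
    "\<forall>i<dim_row T. \<forall>j<dim_col T. T $$ (i, j) \<noteq> 0 \<longrightarrow> r $ j = r' $ i"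
    unfolding uniform_sim_def by fast
  then have "r $ j = r' $ i" "r $ l = r' $ i" using assms(2,3) * by auto
  then show "case x of (r, a) \<Rightarrow> r $ j = r $ l" by (simp add: x)
qed

lemma uniform_sim_Un:
  "uniform_sim V T V'' \<Longrightarrow> uniform_sim V' T V'' \<Longrightarrow> uniform_sim (V \<union> V') T V''"
  unfolding uniform_sim_def ball_Un by (rule conjI)

subsection \<open>The join as a least upper bound\<close>

text \<open>What the least-upper-bound argument uses of the outcome of a join. Row \<open>i\<close>
  of the result stems from the class pair \<open>(cls1 i, cls2 i)\<close>, and \<open>indep\<close>
  and \<open>span\<close> are the two halves of the pushout basis property, each stated for one
  class pair at a time. The description is symmetric in the two arguments, so a fact proved for the
  first transfers to the second through \<open>swap\<close>.\<close>

locale join_data =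
  fixes n d1 d2 p :: nat and S1 S2 T1 T2 :: "rat mat" and V1 V2 :: "(rat vec \<times> rat vec) set"
    and cls1 cls2 :: "nat \<Rightarrow> nat set"
  assumes S1: "S1 \<in> carrier_mat d1 n" and S2: "S2 \<in> carrier_mat d2 n"
    and T1: "T1 \<in> carrier_mat p d1" and T2: "T2 \<in> carrier_mat p d2"
    and vasr1: "is_vasr d1 V1" and vasr2: "is_vasr d2 V2"
    and normal1: "normal S1 V1" and normal2: "normal S2 V2"
    and eq: "T1 * S1 = T2 * S2"
    and cls1: "i < p \<Longrightarrow> cls1 i \<in> coherence_classes d1 V1"
    and cls2: "i < p \<Longrightarrow> cls2 i \<in> coherence_classes d2 V2"
    and supp1: "i < p \<Longrightarrow> j < d1 \<Longrightarrow> T1 $$ (i, j) \<noteq> 0 \<Longrightarrow> j \<in> cls1 i"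
    and supp2: "i < p \<Longrightarrow> j < d2 \<Longrightarrow> T2 $$ (i, j) \<noteq> 0 \<Longrightarrow> j \<in> cls2 i"
    and indep: "(\<And>i. i < p \<Longrightarrow> c i \<noteq> 0 \<Longrightarrow> cls1 i = C1 \<and> cls2 i = C2) \<Longrightarrow>
      (\<And>j. j < d1 \<Longrightarrow> (\<Sum>i<p. c i * T1 $$ (i, j)) = 0) \<Longrightarrow>
      (\<And>j. j < d2 \<Longrightarrow> (\<Sum>i<p. c i * T2 $$ (i, j)) = 0) \<Longrightarrow> i < p \<Longrightarrow> c i = 0"
    and span: "C1 \<in> coherence_classes d1 V1 \<Longrightarrow> C2 \<in> coherence_classes d2 V2 \<Longrightarrow>
      (\<And>j. j < d1 \<Longrightarrow> t1 j \<noteq> 0 \<Longrightarrow> j \<in> C1) \<Longrightarrow> (\<And>j. j < d2 \<Longrightarrow> t2 j \<noteq> 0 \<Longrightarrow> j \<in> C2) \<Longrightarrow>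
      (\<And>k. k < n \<Longrightarrow> (\<Sum>j<d1. t1 j * S1 $$ (j, k)) = (\<Sum>j<d2. t2 j * S2 $$ (j, k))) \<Longrightarrow>
      \<exists>c. (\<forall>i<p. c i \<noteq> 0 \<longrightarrow> cls1 i = C1 \<and> cls2 i = C2) \<and>
        (\<forall>j<d1. t1 j = (\<Sum>i<p. c i * T1 $$ (i, j))) \<and>
        (\<forall>j<d2. t2 j = (\<Sum>i<p. c i * T2 $$ (i, j)))"
begin

lemma swap: "join_data n d2 d1 p S2 S1 T2 T1 V2 V1 cls2 cls1"
proof (unfold_locales, goal_cases)
  \<comment> \<open>Goals 14 and 15 are \<open>indep\<close> and \<open>span\<close>, where
    exchanging the two sides permutes premises and conjuncts.\<close>
  case (14 c C1 C2 i)
  then show ?case using indep[of c C2 C1 i] by blast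
next
  case (15 C1 C2 t1 t2)
  from 15 have "\<exists>c. (\<forall>i<p. c i \<noteq> 0 \<longrightarrow> cls1 i = C2 \<and> cls2 i = C1) \<and>
        (\<forall>j<d1. t2 j = (\<Sum>i<p. c i * T1 $$ (i, j))) \<and>
        (\<forall>j<d2. t1 j = (\<Sum>i<p. c i * T2 $$ (i, j)))" by (intro span) simp_all
  then show ?case by blast
qed (rule S1 S2 T1 T2 vasr1 vasr2 normal1 normal2 eq[symmetric] cls1 cls2 supp1 supp2; assumption)+

text \<open>The arbitrary choice inside \<open>tri\<close> is harmless: all nonzero columns of row
  \<open>i\<close> lie in one coherence class, on which \<open>r\<close> is constant.\<close>

lemma tri_index:
  assumes "i < p" "j < d1" "T1 $$ (i, j) \<noteq> 0" "(r, a) \<in> V1"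
  shows "tri T1 r $ i = r $ j"
proof -
  define l where "l = (SOME j. j < dim_col T1 \<and> T1 $$ (i, j) \<noteq> 0)"
  have ex: "\<exists>j. j < dim_col T1 \<and> T1 $$ (i, j) \<noteq> 0" using assms T1 by auto
  then have "l < dim_col T1 \<and> T1 $$ (i, l) \<noteq> 0" unfolding l_def by (rule someI_ex)
  then have "l \<in> cls1 i" using supp1[OF assms(1), of l] T1 by auto
  then have "r $ l = r $ j"
    using coherence_class_eq[OF cls1[OF assms(1)] _ supp1[OF assms(1-3)] assms(4)] by blast
  then show ?thesis using ex assms(1) T1 by (auto simp: tri_def l_def)
qed

text \<open>The extra set \<open>W\<close> stands for the image of the other argument.\<close>

lemma image_sim: "uniform_sim V1 T1 (image_vasr V1 T1 \<union> W)"
  unfolding uniform_sim_def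
proof (safe, goal_cases)
  case (1 r a)
  then have "(tri T1 r, T1 *\<^sub>v a) \<in> image_vasr V1 T1 \<union> W" by (force simp: image_vasr_def)
  then show ?case using tri_index 1 T1 by (intro bexI) auto
qed

lemma image_is_vasr: "is_vasr p (image_vasr V1 T1)"
proof -
  have "tri T1 r \<in> carrier_vec p \<and> T1 *\<^sub>v a \<in> carrier_vec p \<and>
      (\<forall>i<p. tri T1 r $ i = 0 \<or> tri T1 r $ i = 1)" if "(r, a) \<in> V1" for r a
  proof (intro conjI allI impI)
    fix i assume i: "i < p"
    show "tri T1 r $ i = 0 \<or> tri T1 r $ i = 1"
    proof (cases "\<exists>j<d1. T1 $$ (i, j) \<noteq> 0")
      case True
      then obtain j where j: "j < d1" "T1 $$ (i, j) \<noteq> 0" by blast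
      show ?thesis using tri_index[OF i j that] vasr1 that j(1) by (auto simp: is_vasr_def)
    next
      case False
      \<comment> \<open>On a zero row \<open>tri\<close> takes the value 0, which is an admissible
        reset factor.\<close>
      then show ?thesis using T1 i by (auto simp: tri_def)
    qed
  next
    have "a \<in> carrier_vec d1" using vasr1 that by (auto simp: is_vasr_def)
    with T1 show "T1 *\<^sub>v a \<in> carrier_vec p" by (rule mult_mat_vec_carrier)
  qed (use T1 in \<open>auto simp: tri_def\<close>)
  then show ?thesis using vasr1 by (auto simp: is_vasr_def image_vasr_def)
qed

lemma comb_mult:
  assumes "k < n"
  shows "(\<Sum>j<d1. (\<Sum>i<p. c i * T1 $$ (i, j)) * S1 $$ (j, k)) = (\<Sum>i<p. c i * (T1 * S1) $$ (i, k))"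
proof -
  have "(\<Sum>j<d1. (\<Sum>i<p. c i * T1 $$ (i, j)) * S1 $$ (j, k)) =
      (\<Sum>j<d1. \<Sum>i<p. c i * (T1 $$ (i, j) * S1 $$ (j, k)))"
    by (simp add: sum_distrib_right mult.assoc)
  also have "\<dots> = (\<Sum>i<p. c i * (\<Sum>j<d1. T1 $$ (i, j) * S1 $$ (j, k)))"
    by (subst sum.swap) (simp add: sum_distrib_left)
  also have "\<dots> = (\<Sum>i<p. c i * (T1 * S1) $$ (i, k))"
    by (rule sum.cong) (use mult_mat_index[OF T1 S1 _ assms] in auto)
  finally show ?thesis .
qed

text \<open>The combination of the rows of \<open>T1\<close> is supported in \<open>C1\<close>,
  hence coherent, and \<open>S1\<close> sends it to zero; normality of the first argument makes it
  vanish.\<close>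

lemma comb_zero:
  assumes "C1 \<in> coherence_classes d1 V1" "\<And>i. i < p \<Longrightarrow> c i \<noteq> 0 \<Longrightarrow> cls1 i = C1"
    and "\<And>k. k < n \<Longrightarrow> (\<Sum>i<p. c i * (T1 * S1) $$ (i, k)) = 0" and "j < d1"
  shows "(\<Sum>i<p. c i * T1 $$ (i, j)) = 0"
proof (rule normalD[OF normal1 S1 _ _ assms(4)])
  show "coherent d1 V1 (\<lambda>j. \<Sum>i<p. c i * T1 $$ (i, j))"
  proof (rule coherent_if_class[OF assms(1)])
    fix j assume j: "j < d1" and "(\<Sum>i<p. c i * T1 $$ (i, j)) \<noteq> 0"
    then obtain i where "i < p" "c i * T1 $$ (i, j) \<noteq> 0"
      by (metis (no_types, lifting) lessThan_iff sum.neutral)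
    then show "j \<in> C1" using assms(2)[of i] supp1[of i j] j by auto
  qed
qed (simp add: comb_mult assms(3))

lemma row_zero_swap:
  assumes "i < p" "\<And>j. j < d1 \<Longrightarrow> T1 $$ (i, j) = 0" "j < d2"
  shows "T2 $$ (i, j) = 0"
proof (rule normalD[OF normal2 S2 _ _ assms(3)])
  show "coherent d2 V2 (\<lambda>j. T2 $$ (i, j))"
    by (rule coherent_if_class[OF cls2[OF assms(1)]]) (use supp2 assms(1) in blast)
  fix k assume k: "k < n"
  have "(\<Sum>j<d2. T2 $$ (i, j) * S2 $$ (j, k)) = (T1 * S1) $$ (i, k)"
    using mult_mat_index[OF T2 S2 assms(1) k] by (simp add: eq)
  also have "\<dots> = 0" using mult_mat_index[OF T1 S1 assms(1) k] assms(2) by simp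
  finally show "(\<Sum>j<d2. T2 $$ (i, j) * S2 $$ (j, k)) = 0" .
qed

text \<open>This is the condition under which \<open>tri\<close> is meaningful. If row
  \<open>i\<close> of \<open>T1\<close> were zero, then by \<open>row_zero_swap\<close> so would be
  row \<open>i\<close> of \<open>T2\<close>, and the unit coefficient vector at \<open>i\<close>
  would be a relation excluded by \<open>indep\<close>.\<close>

lemma row_nonzero:
  assumes "i < p"
  obtains j where "j < d1" "T1 $$ (i, j) \<noteq> 0"
proof (rule ccontr)
  assume "\<not> thesis"
  with that have z1: "\<And>j. j < d1 \<Longrightarrow> T1 $$ (i, j) = 0" by blast
  with assms have z2: "\<And>j. j < d2 \<Longrightarrow> T2 $$ (i, j) = 0" using row_zero_swap by blast
  have single: "(\<Sum>l<p. (if l = i then 1 else 0) * f l) = f i" for f :: "nat \<Rightarrow> rat"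
  proof -
    have "(\<Sum>l<p. (if l = i then 1 else 0) * f l) = (\<Sum>l<p. if l = i then f l else 0)"
      by (rule sum.cong) auto
    then show ?thesis using assms by simp
  qed
  have "(if i = i then 1 else 0) = (0 :: rat)"
    by (rule indep[of "\<lambda>l. if l = i then 1 else 0" "cls1 i" "cls2 i"])
      (use z1 z2 assms in \<open>auto simp only: single split: if_splits\<close>)
  then show False by simp
qed

text \<open>Through nonzero entries of the two rows, \<open>tri\<close> shows the reset factors of
  \<open>V1\<close> at one column of each class. Rows coherent in the image therefore come from the
  same class of \<open>V1\<close>; applied on both sides, from the same class pair.\<close>

lemma image_coherent_cls:
  assumes "coherent p (image_vasr V1 T1 \<union> W) t" "i < p" "l < p" "t i \<noteq> 0" "t l \<noteq> 0"
  shows "cls1 i = cls1 l"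
proof -
  obtain j where j: "j < d1" "T1 $$ (i, j) \<noteq> 0" using row_nonzero[OF assms(2)] .
  obtain j' where j': "j' < d1" "T1 $$ (l, j') \<noteq> 0" using row_nonzero[OF assms(3)] .
  show ?thesis
  proof (rule coherence_class_unique[OF cls1[OF assms(2)] cls1[OF assms(3)]])
    show "j \<in> cls1 i" "j' \<in> cls1 l" using supp1 assms j j' by auto
    fix r a assume ra: "(r, a) \<in> V1"
    then have "(tri T1 r, T1 *\<^sub>v a) \<in> image_vasr V1 T1" by (force simp: image_vasr_def)
    then have "tri T1 r $ i = tri T1 r $ l" using assms unfolding coherent_def by fast
    then show "r $ j = r $ j'" using tri_index[OF _ j ra] tri_index[OF _ j' ra] assms(2,3) by simp
  qed
qed

text \<open>A coherent \<open>t\<close> with a nonzero entry \<open>l\<close> uses only rows of the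
  class pair of \<open>l\<close>. If it annihilates the rows of the join, \<open>comb_zero\<close>
  turns it into a relation among the rows of \<open>T1\<close> and of \<open>T2\<close> separately,
  and \<open>indep\<close> finishes.\<close>

lemma join_normal: "normal (T1 * S1) (image_vasr V1 T1 \<union> image_vasr V2 T2)"
  unfolding normal_def
proof (intro allI impI)
  interpret swap: join_data n d2 d1 p S2 S1 T2 T1 V2 V1 cls2 cls1 by (rule swap)
  have dims: "dim_row (T1 * S1) = p" "dim_col (T1 * S1) = n" using T1 S1 by auto
  fix t l
  assume "coherent (dim_row (T1 * S1)) (image_vasr V1 T1 \<union> image_vasr V2 T2) t"
    and "\<forall>k<dim_col (T1 * S1). (\<Sum>j<dim_row (T1 * S1). t j * (T1 * S1) $$ (j, k)) = 0"
    and "l < dim_row (T1 * S1)"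
  then have coh: "coherent p (image_vasr V1 T1 \<union> image_vasr V2 T2) t"
    and z: "\<And>k. k < n \<Longrightarrow> (\<Sum>j<p. t j * (T1 * S1) $$ (j, k)) = 0" and l: "l < p"
    unfolding dims by auto
  have coh': "coherent p (image_vasr V2 T2 \<union> image_vasr V1 T1) t"
    using coh by (simp add: Un_commute)
  show "t l = 0"
  proof (rule ccontr)
    assume tl: "t l \<noteq> 0"
    have c1: "cls1 i = cls1 l" if "i < p" "t i \<noteq> 0" for i
      by (rule image_coherent_cls[OF coh that(1) l that(2) tl])
    have c2: "cls2 i = cls2 l" if "i < p" "t i \<noteq> 0" for i
      by (rule swap.image_coherent_cls[OF coh' that(1) l that(2) tl])
    have "t l = 0"
    proof (rule indep[OF _ _ _ l])
      show "cls1 i = cls1 l \<and> cls2 i = cls2 l" if "i < p" "t i \<noteq> 0" for i using c1 c2 that by blast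
      show "(\<Sum>i<p. t i * T1 $$ (i, j)) = 0" if "j < d1" for j
        by (rule comb_zero[OF cls1[OF l] c1 z that])
      show "(\<Sum>i<p. t i * T2 $$ (i, j)) = 0" if "j < d2" for j
        by (rule swap.comb_zero[OF cls2[OF l] c2 z[unfolded eq] that])
    qed
    with tl show False ..
  qed
qed

text \<open>A simulation by \<open>R\<close> passes to the factor \<open>T\<close>. The premise
  \<open>meet\<close> ties every row \<open>l\<close> used by row \<open>i\<close> of
  \<open>T\<close> to a column that row \<open>i\<close> of \<open>R\<close> really uses and that
  lies in the class of \<open>l\<close>. The reset factor at \<open>l\<close> is then the one
  prescribed by the simulation \<open>R\<close>.\<close>

lemma factor_sim:
  assumes R: "R \<in> carrier_mat e d1" "uniform_sim V1 R V'" and T: "T \<in> carrier_mat e p"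
    and TR: "T * T1 = R"
    and meet: "\<And>i l. i < e \<Longrightarrow> l < p \<Longrightarrow> T $$ (i, l) \<noteq> 0 \<Longrightarrow> \<exists>j<d1. R $$ (i, j) \<noteq> 0 \<and> j \<in> cls1 l"
  shows "uniform_sim (image_vasr V1 T1) T V'"
  unfolding uniform_sim_def
proof (safe, goal_cases)
  case (1 r' b)
  then obtain r a where ra: "(r, a) \<in> V1" "r' = tri T1 r" "b = T1 *\<^sub>v a"
    by (auto simp: image_vasr_def)
  have a: "a \<in> carrier_vec d1" using vasr1 ra(1) by (auto simp: is_vasr_def)
  from uniform_simE[OF R(2,1) vasr1 ra(1)] obtain s where s: "(s, R *\<^sub>v a) \<in> V'"
    "\<And>i j. i < e \<Longrightarrow> j < d1 \<Longrightarrow> R $$ (i, j) \<noteq> 0 \<Longrightarrow> r $ j = s $ i" by metis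
  have "T *\<^sub>v b = R *\<^sub>v a" using assoc_mult_mat_vec[OF T T1 a] ra(3) TR by simp
  moreover have "r' $ l = s $ i" if il: "i < e" "l < p" "T $$ (i, l) \<noteq> 0" for i l
  proof -
    obtain j where j: "j < d1" "R $$ (i, j) \<noteq> 0" "j \<in> cls1 l" using meet[OF il] by blast
    obtain j' where j': "j' < d1" "T1 $$ (l, j') \<noteq> 0" using row_nonzero[OF il(2)] .
    have "r' $ l = r $ j'" using tri_index[OF il(2) j' ra(1)] ra(2) by simp
    also have "\<dots> = r $ j"
      using coherence_class_eq[OF cls1[OF il(2)] supp1[OF il(2) j'] j(3) ra(1)] .
    also have "\<dots> = s $ i" by (rule s(2)[OF il(1) j(1,2)])
    finally show ?thesis .
  qed
  ultimately show ?case using s(1) T by (intro bexI[OF _ s(1)]) auto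
qed

text \<open>Normality excludes a row that vanishes on one side only; such a row would pick out no
  pair of classes in \<open>join_least\<close>.\<close>

lemma rows_zero_transfer:
  assumes R1: "R1 \<in> carrier_mat e d1" and R2: "R2 \<in> carrier_mat e d2" "uniform_sim V2 R2 V'"
    and eq': "R1 * S1 = R2 * S2" and i: "i < e"
    and z: "\<And>j. j < d1 \<Longrightarrow> R1 $$ (i, j) = 0" and j: "j < d2"
  shows "R2 $$ (i, j) = 0"
proof (rule normalD[OF normal2 S2 uniform_sim_coherent[OF R2(2,1) i] _ j])
  fix k assume k: "k < n"
  have "(\<Sum>j<d2. R2 $$ (i, j) * S2 $$ (j, k)) = (R1 * S1) $$ (i, k)"
    using mult_mat_index[OF R2(1) S2 i k] by (simp add: eq')
  also have "\<dots> = 0" using mult_mat_index[OF R1 S1 i k] z by simp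
  finally show "(\<Sum>j<d2. R2 $$ (i, j) * S2 $$ (j, k)) = 0" .
qed

text \<open>Row \<open>i\<close> is either zero in both \<open>R1\<close> and \<open>R2\<close>, and
  then zero in \<open>T\<close>, or it is supported in one class on each side. In the second case
  \<open>R1 * S1 = R2 * S2\<close> puts the pair of rows into the pushout of these two classes, and
  its coordinates there form row \<open>i\<close> of \<open>T\<close>. The same \<open>T\<close>
  thus factors both simulations.\<close>

lemma join_least:
  assumes R1: "R1 \<in> carrier_mat e d1" "uniform_sim V1 R1 V'"
    and R2: "R2 \<in> carrier_mat e d2" "uniform_sim V2 R2 V'"
    and eq': "R1 * S1 = R2 * S2"
  shows "\<exists>T\<in>carrier_mat e p. uniform_sim (image_vasr V1 T1 \<union> image_vasr V2 T2) T V' \<and>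
    T * (T1 * S1) = R1 * S1"
proof -
  interpret swap: join_data n d2 d1 p S2 S1 T2 T1 V2 V1 cls2 cls1 by (rule swap)
  \<comment> \<open>The coefficients of one row of \<open>T\<close>. The first conjunct records the
    premise \<open>meet\<close> of \<open>factor_sim\<close> for both sides.\<close>
  define Q where "Q i c \<longleftrightarrow>
    (\<forall>l<p. c l \<noteq> 0 \<longrightarrow> (\<exists>j<d1. R1 $$ (i, j) \<noteq> 0 \<and> j \<in> cls1 l) \<and> (\<exists>j<d2. R2 $$ (i, j) \<noteq> 0 \<and> j \<in> cls2 l)) \<and>
    (\<forall>j<d1. R1 $$ (i, j) = (\<Sum>l<p. c l * T1 $$ (l, j))) \<and>
    (\<forall>j<d2. R2 $$ (i, j) = (\<Sum>l<p. c l * T2 $$ (l, j)))" for i and c :: "nat \<Rightarrow> rat"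
  have ex: "\<exists>c. Q i c" if i: "i < e" for i
  proof (cases "\<forall>j<d1. R1 $$ (i, j) = 0")
    case True
    then have "\<forall>j<d2. R2 $$ (i, j) = 0"
      using rows_zero_transfer[OF R1(1) R2 eq' i] by blast
    with True have "Q i (\<lambda>_. 0)" by (simp add: Q_def)
    then show ?thesis by blast
  next
    case False
    then obtain j1 where j1: "j1 < d1" "R1 $$ (i, j1) \<noteq> 0" by blast
    obtain j2 where j2: "j2 < d2" "R2 $$ (i, j2) \<noteq> 0"
      using False swap.rows_zero_transfer[OF R2(1) R1 eq'[symmetric] i] by blast
    obtain C1 where C1: "C1 \<in> coherence_classes d1 V1" "j1 \<in> C1"
      "\<And>j. j < d1 \<Longrightarrow> R1 $$ (i, j) \<noteq> 0 \<Longrightarrow> j \<in> C1"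
      using coherent_class[OF uniform_sim_coherent[OF R1(2,1) i] j1] by blast
    obtain C2 where C2: "C2 \<in> coherence_classes d2 V2" "j2 \<in> C2"
      "\<And>j. j < d2 \<Longrightarrow> R2 $$ (i, j) \<noteq> 0 \<Longrightarrow> j \<in> C2"
      using coherent_class[OF uniform_sim_coherent[OF R2(2,1) i] j2] by blast
    have "(\<Sum>j<d1. R1 $$ (i, j) * S1 $$ (j, k)) = (\<Sum>j<d2. R2 $$ (i, j) * S2 $$ (j, k))"
      if "k < n" for k
      using mult_mat_index[OF R1(1) S1 i that] mult_mat_index[OF R2(1) S2 i that] eq' by simp
    from span[OF C1(1) C2(1) C1(3) C2(3) this]
    obtain c where "\<forall>l<p. c l \<noteq> 0 \<longrightarrow> cls1 l = C1 \<and> cls2 l = C2"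
      "\<forall>j<d1. R1 $$ (i, j) = (\<Sum>l<p. c l * T1 $$ (l, j))"
      "\<forall>j<d2. R2 $$ (i, j) = (\<Sum>l<p. c l * T2 $$ (l, j))" by blast
    then have "Q i c" unfolding Q_def using j1 j2 C1(2) C2(2) by blast
    then show ?thesis by blast
  qed
  then have "\<forall>i. \<exists>c. i < e \<longrightarrow> Q i c" by blast
  from choice[OF this] obtain c where "\<And>i. i < e \<Longrightarrow> Q i (c i)" by blast
  then have c: "\<And>i l. i < e \<Longrightarrow> l < p \<Longrightarrow> c i l \<noteq> 0 \<Longrightarrow> \<exists>j<d1. R1 $$ (i, j) \<noteq> 0 \<and> j \<in> cls1 l"
    "\<And>i l. i < e \<Longrightarrow> l < p \<Longrightarrow> c i l \<noteq> 0 \<Longrightarrow> \<exists>j<d2. R2 $$ (i, j) \<noteq> 0 \<and> j \<in> cls2 l"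
    "\<And>i j. i < e \<Longrightarrow> j < d1 \<Longrightarrow> R1 $$ (i, j) = (\<Sum>l<p. c i l * T1 $$ (l, j))"
    "\<And>i j. i < e \<Longrightarrow> j < d2 \<Longrightarrow> R2 $$ (i, j) = (\<Sum>l<p. c i l * T2 $$ (l, j))"
    unfolding Q_def by blast+
  define T where "T = mat e p (\<lambda>(i, l). c i l)"
  have T: "T \<in> carrier_mat e p" and T_index: "\<And>i l. i < e \<Longrightarrow> l < p \<Longrightarrow> T $$ (i, l) = c i l"
    by (auto simp: T_def)
  have TR1: "T * T1 = R1"
  proof (rule eq_matI)
    fix i j assume "i < dim_row R1" "j < dim_col R1"
    then have ij: "i < e" "j < d1" using R1(1) by auto
    show "(T * T1) $$ (i, j) = R1 $$ (i, j)"
      unfolding mult_mat_index[OF T T1 ij] c(3)[OF ij] by (rule sum.cong) (use T_index ij in auto)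
  qed (use T T1 R1(1) in auto)
  have TR2: "T * T2 = R2"
  proof (rule eq_matI)
    fix i j assume "i < dim_row R2" "j < dim_col R2"
    then have ij: "i < e" "j < d2" using R2(1) by auto
    show "(T * T2) $$ (i, j) = R2 $$ (i, j)"
      unfolding mult_mat_index[OF T T2 ij] c(4)[OF ij] by (rule sum.cong) (use T_index ij in auto)
  qed (use T T2 R2(1) in auto)
  have "uniform_sim (image_vasr V1 T1) T V'"
    by (rule factor_sim[OF R1 T TR1]) (use c(1) T_index in auto)
  moreover have "uniform_sim (image_vasr V2 T2) T V'"
    by (rule swap.factor_sim[OF R2 T TR2]) (use c(2) T_index in auto)
  moreover have "T * (T1 * S1) = R1 * S1"
    using assoc_mult_mat[OF T T1 S1] TR1 by simp
  ultimately show ?thesis using T uniform_sim_Un by blast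
qed

end

subsection \<open>The join algorithm\<close>

abbreviation class_list :: "nat set \<Rightarrow> nat list" where
  "class_list C \<equiv> sorted_list_of_set C"

lemma class_list_nth:
  assumes "finite C" "i < card C"
  shows "class_list C ! i \<in> C"
  using nth_mem[of i "class_list C"] assms by simp

lemma sum_class_list:
  fixes f :: "nat \<Rightarrow> 'a :: comm_monoid_add"
  assumes "C \<subseteq> {..<d}" "\<And>j. j < d \<Longrightarrow> j \<notin> C \<Longrightarrow> f j = 0"
  shows "(\<Sum>j<d. f j) = (\<Sum>i<card C. f (class_list C ! i))"
proof -
  have fin: "finite C" using assms(1) by (rule finite_subset) simp
  have "(\<Sum>j<d. f j) = (\<Sum>j\<in>C. f j)"
    using assms by (intro sum.mono_neutral_right) auto
  also have "\<dots> = (\<Sum>i<card C. f (class_list C ! i))"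
    by (rule sum.reindex_bij_betw[symmetric], rule bij_betw_nth) (use fin in auto)
  finally show ?thesis .
qed

lemma proj_carrier: "proj d C \<in> carrier_mat (card C) d"
  by (rule carrier_matI) (simp_all add: proj_def)

lemma proj_index:
  assumes "finite C" "i < card C" "j < d"
  shows "proj d C $$ (i, j) = (if j = class_list C ! i then 1 else 0)"
  using assms by (simp add: proj_def mat_of_rows_index unit_vec_def)

lemma proj_mult_index:
  assumes "C \<subseteq> {..<d}" "S \<in> carrier_mat d n" "i < card C" "k < n"
  shows "(proj d C * S) $$ (i, k) = S $$ (class_list C ! i, k)"
proof -
  have fin: "finite C" using assms(1) by (rule finite_subset) simp
  have lt: "class_list C ! i < d" using class_list_nth[OF fin assms(3)] assms(1) by auto
  have "(proj d C * S) $$ (i, k) = (\<Sum>j<d. if j = class_list C ! i then S $$ (j, k) else 0)"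
    unfolding mult_mat_index[OF proj_carrier assms(2-4)]
    by (rule sum.cong) (use proj_index[OF fin assms(3)] in auto)
  then show ?thesis using lt by simp
qed

lemma mult_proj_index:
  assumes "C \<subseteq> {..<d}" "U \<in> carrier_mat q (card C)" "l < q"
  shows "i < card C \<Longrightarrow> (U * proj d C) $$ (l, class_list C ! i) = U $$ (l, i)"
    and "j < d \<Longrightarrow> j \<notin> C \<Longrightarrow> (U * proj d C) $$ (l, j) = 0"
proof -
  have fin: "finite C" using assms(1) by (rule finite_subset) simp
  show "(U * proj d C) $$ (l, class_list C ! i) = U $$ (l, i)" if i: "i < card C"
  proof -
    have lt: "class_list C ! i < d" using class_list_nth[OF fin i] assms(1) by auto
    have "(U * proj d C) $$ (l, class_list C ! i) = (\<Sum>i'<card C. if i' = i then U $$ (l, i') else 0)"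
      unfolding mult_mat_index[OF assms(2) proj_carrier assms(3) lt]
      by (rule sum.cong)
        (use proj_index[OF fin _ lt] i fin nth_eq_iff_index_eq[of "class_list C"] in auto)
    then show ?thesis using i by simp
  qed
  show "(U * proj d C) $$ (l, j) = 0" if j: "j < d" "j \<notin> C"
    unfolding mult_mat_index[OF assms(2) proj_carrier assms(3) j(1)]
    by (rule sum.neutral) (use proj_index[OF fin _ j(1)] class_list_nth[OF fin] j(2) in auto)
qed

section \<open>The pushout for one pair of coherence classes\<close>

definition pushout_space :: "rat mat \<Rightarrow> rat mat \<Rightarrow> rat vec set" where
  "pushout_space A B = {w \<in> carrier_vec (dim_row A + dim_row B).
     transpose_mat A *\<^sub>v vec_first w (dim_row A) = transpose_mat B *\<^sub>v vec_last w (dim_row B)}"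

lemma transpose_mult_index:
  fixes A :: "rat mat"
  assumes "A \<in> carrier_mat q n" "v \<in> carrier_vec q" "k < n"
  shows "(transpose_mat A *\<^sub>v v) $ k = (\<Sum>i<q. v $ i * A $$ (i, k))"
proof -
  have "transpose_mat A \<in> carrier_mat n q" using assms(1) by simp
  from mult_mat_vec_index[OF this assms(2,3)] show ?thesis
    using assms(1,3) by (simp add: mult.commute)
qed

lemma pushout_space_iff:
  assumes "A \<in> carrier_mat q1 n" "B \<in> carrier_mat q2 n" "u1 \<in> carrier_vec q1" "u2 \<in> carrier_vec q2"
  shows "u1 @\<^sub>v u2 \<in> pushout_space A B \<longleftrightarrow>
    (\<forall>k<n. (\<Sum>i<q1. u1 $ i * A $$ (i, k)) = (\<Sum>i<q2. u2 $ i * B $$ (i, k)))"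
proof -
  have first: "vec_first (u1 @\<^sub>v u2) q1 = u1" and last: "vec_last (u1 @\<^sub>v u2) q2 = u2"
    using assms(3,4) by (auto simp: vec_first_def vec_last_def)
  have "u1 @\<^sub>v u2 \<in> pushout_space A B \<longleftrightarrow> transpose_mat A *\<^sub>v u1 = transpose_mat B *\<^sub>v u2"
    using assms first last by (simp add: pushout_space_def)
  also have "\<dots> \<longleftrightarrow> (\<forall>k<n. (transpose_mat A *\<^sub>v u1) $ k = (transpose_mat B *\<^sub>v u2) $ k)"
    unfolding vec_eq_iff using assms(1,2) by simp
  finally show ?thesis
    using transpose_mult_index[OF assms(1,3)] transpose_mult_index[OF assms(2,4)] by simp
qed

lemma pushout_exists:
  assumes A: "A \<in> carrier_mat q1 n" and B: "B \<in> carrier_mat q2 n"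
  shows "\<exists>U. pushout A B U"
proof -
  have W: "pushout_space A B = {w \<in> carrier_vec (q1 + q2).
     transpose_mat A *\<^sub>v vec_first w q1 = transpose_mat B *\<^sub>v vec_last w q2}"
    using A B by (simp add: pushout_space_def)
  have tA: "transpose_mat A \<in> carrier_mat n q1" and tB: "transpose_mat B \<in> carrier_mat n q2"
    using A B by auto
  have first: "vec_first (x + q \<cdot>\<^sub>v y) q1 = vec_first x q1 + q \<cdot>\<^sub>v vec_first y q1"
    if "x \<in> carrier_vec (q1 + q2)" "y \<in> carrier_vec (q1 + q2)" for x y :: "rat vec" and q
    using that by (intro eq_vecI) (auto simp: vec_first_def)
  have last: "vec_last (x + q \<cdot>\<^sub>v y) q2 = vec_last x q2 + q \<cdot>\<^sub>v vec_last y q2"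
    if "x \<in> carrier_vec (q1 + q2)" "y \<in> carrier_vec (q1 + q2)" for x y :: "rat vec" and q
    using that by (intro eq_vecI) (auto simp: vec_last_def)
  have lin: "D *\<^sub>v (v + q \<cdot>\<^sub>v w) = D *\<^sub>v v + q \<cdot>\<^sub>v (D *\<^sub>v w)"
    if "D \<in> carrier_mat e d" "v \<in> carrier_vec d" "w \<in> carrier_vec d"
    for D :: "rat mat" and e d v w q
    using that mult_add_distrib_mat_vec[OF that(1,2), of "q \<cdot>\<^sub>v w"] mult_mat_vec[OF that(1,3)] by simp
  obtain L where L: "is_basis (q1 + q2) (pushout_space A B) L"
  proof (rule basis_exists[of "pushout_space A B" "q1 + q2"])
    show sub: "pushout_space A B \<subseteq> carrier_vec (q1 + q2)" by (auto simp: W)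
    have "0\<^sub>v q1 @\<^sub>v 0\<^sub>v q2 \<in> pushout_space A B"
      unfolding pushout_space_iff[OF A B zero_carrier_vec zero_carrier_vec] by simp
    moreover have "0\<^sub>v q1 @\<^sub>v 0\<^sub>v q2 = (0\<^sub>v (q1 + q2) :: rat vec)" by (rule eq_vecI) auto
    ultimately show "0\<^sub>v (q1 + q2) \<in> pushout_space A B" by simp
    show "x + q \<cdot>\<^sub>v y \<in> pushout_space A B" if "x \<in> pushout_space A B" "y \<in> pushout_space A B" for x y q
    proof -
      have xy: "x \<in> carrier_vec (q1 + q2)" "y \<in> carrier_vec (q1 + q2)" using sub that by auto
      have "transpose_mat A *\<^sub>v vec_first (x + q \<cdot>\<^sub>v y) q1 = transpose_mat B *\<^sub>v vec_last (x + q \<cdot>\<^sub>v y) q2"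
        unfolding first[OF xy] last[OF xy] lin[OF tA vec_first_carrier vec_first_carrier]
          lin[OF tB vec_last_carrier vec_last_carrier]
        using that by (simp add: W)
      with xy show ?thesis by (simp add: W)
    qed
  qed
  define p where "p = length L"
  define U1 where "U1 = mat p q1 (\<lambda>(l, i). L ! l $ i)"
  define U2 where "U2 = mat p q2 (\<lambda>(l, i). L ! l $ (q1 + i))"
  have "row U1 l @\<^sub>v row U2 l = L ! l" if "l < p" for l
  proof (rule eq_vecI)
    have "L ! l \<in> pushout_space A B" using L that by (auto simp: is_basis_def p_def)
    then have dim: "dim_vec (L ! l) = q1 + q2" by (auto simp: W)
    then show "dim_vec (row U1 l @\<^sub>v row U2 l) = dim_vec (L ! l)" by (simp add: U1_def U2_def)
    fix i assume "i < dim_vec (L ! l)"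
    then show "(row U1 l @\<^sub>v row U2 l) $ i = L ! l $ i"
      using that dim by (auto simp: U1_def U2_def)
  qed
  then have "map (\<lambda>l. row U1 l @\<^sub>v row U2 l) [0..<p] = L"
    by (intro nth_equalityI) (auto simp: p_def)
  then have "pushout A B (U1, U2)"
    unfolding pushout_def using L A B
    by (intro exI[of _ U1] exI[of _ U2] exI[of _ p]) (auto simp: U1_def U2_def pushout_space_def)
  then show ?thesis by blast
qed

text \<open>The interface of \<open>join_data\<close> restricted to a single class pair.
  \<open>P1\<close> and \<open>P2\<close> have one column per abstract dimension, not per class
  member, so that blocks of different pairs can be stacked.\<close>

definition block ::
  "nat \<Rightarrow> nat \<Rightarrow> nat \<Rightarrow> rat mat \<Rightarrow> rat mat \<Rightarrow> nat set \<Rightarrow> nat set \<Rightarrow> nat \<Rightarrow> rat mat \<Rightarrow> rat mat \<Rightarrow> bool" where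
  "block n d1 d2 S1 S2 C1 C2 q P1 P2 \<longleftrightarrow>
    P1 \<in> carrier_mat q d1 \<and> P2 \<in> carrier_mat q d2 \<and> P1 * S1 = P2 * S2 \<and>
    (\<forall>l<q. \<forall>j<d1. P1 $$ (l, j) \<noteq> 0 \<longrightarrow> j \<in> C1) \<and>
    (\<forall>l<q. \<forall>j<d2. P2 $$ (l, j) \<noteq> 0 \<longrightarrow> j \<in> C2) \<and>
    (\<forall>c. (\<forall>j<d1. (\<Sum>l<q. c l * P1 $$ (l, j)) = 0) \<longrightarrow>
      (\<forall>j<d2. (\<Sum>l<q. c l * P2 $$ (l, j)) = 0) \<longrightarrow> (\<forall>l<q. c l = 0)) \<and>
    (\<forall>t1 t2. (\<forall>j<d1. t1 j \<noteq> 0 \<longrightarrow> j \<in> C1) \<longrightarrow> (\<forall>j<d2. t2 j \<noteq> 0 \<longrightarrow> j \<in> C2) \<longrightarrow>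
      (\<forall>k<n. (\<Sum>j<d1. t1 j * S1 $$ (j, k)) = (\<Sum>j<d2. t2 j * S2 $$ (j, k))) \<longrightarrow>
      (\<exists>c. (\<forall>j<d1. t1 j = (\<Sum>l<q. c l * P1 $$ (l, j))) \<and>
        (\<forall>j<d2. t2 j = (\<Sum>l<q. c l * P2 $$ (l, j)))))"

lemma pushout_block:
  assumes S1: "S1 \<in> carrier_mat d1 n" and S2: "S2 \<in> carrier_mat d2 n"
    and C1: "C1 \<subseteq> {..<d1}" and C2: "C2 \<subseteq> {..<d2}"
    and U: "pushout (proj d1 C1 * S1) (proj d2 C2 * S2) U"
  shows "block n d1 d2 S1 S2 C1 C2 (dim_row (fst U)) (fst U * proj d1 C1) (snd U * proj d2 C2)"
proof -
  define q1 q2 where "q1 = card C1" and "q2 = card C2"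
  have fin: "finite C1" "finite C2" by (simp_all add: finite_subset[OF C1] finite_subset[OF C2])
  have A: "proj d1 C1 * S1 \<in> carrier_mat q1 n" and B: "proj d2 C2 * S2 \<in> carrier_mat q2 n"
    unfolding q1_def q2_def by (rule mult_carrier_mat[OF proj_carrier], fact)+
  then have dims: "dim_row (proj d1 C1 * S1) = q1" "dim_row (proj d2 C2 * S2) = q2" by auto
  from U[unfolded pushout_def dims] obtain U1 U2 q where U12: "U = (U1, U2)"
    and U1: "U1 \<in> carrier_mat q q1" and U2: "U2 \<in> carrier_mat q q2"
    and basis: "is_basis (q1 + q2) (pushout_space (proj d1 C1 * S1) (proj d2 C2 * S2))
      (map (\<lambda>i. row U1 i @\<^sub>v row U2 i) [0..<q])"
    unfolding pushout_space_def dims by auto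
  define P1 P2 where "P1 = U1 * proj d1 C1" and "P2 = U2 * proj d2 C2"
  have P1: "P1 \<in> carrier_mat q d1"
    unfolding P1_def by (rule mult_carrier_mat[OF U1]) (simp add: q1_def proj_carrier)
  have P2: "P2 \<in> carrier_mat q d2"
    unfolding P2_def by (rule mult_carrier_mat[OF U2]) (simp add: q2_def proj_carrier)
  note P1_index = mult_proj_index[OF C1 U1[unfolded q1_def], folded q1_def P1_def]
  note P2_index = mult_proj_index[OF C2 U2[unfolded q2_def], folded q2_def P2_def]
  \<comment> \<open>Sums along the class list become sums over all columns when the coefficients
    vanish off the class. This translates between pushout coordinates and abstract
    dimensions.\<close>
  have reindex1: "(\<Sum>i<q1. t (class_list C1 ! i) * (proj d1 C1 * S1) $$ (i, k)) =
      (\<Sum>j<d1. t j * S1 $$ (j, k))" if "\<And>j. j < d1 \<Longrightarrow> j \<notin> C1 \<Longrightarrow> t j = 0" "k < n" for t k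
    using sum_class_list[OF C1, of "\<lambda>j. t j * S1 $$ (j, k)"] that proj_mult_index[OF C1 S1]
    by (simp add: q1_def)
  have reindex2: "(\<Sum>i<q2. t (class_list C2 ! i) * (proj d2 C2 * S2) $$ (i, k)) =
      (\<Sum>j<d2. t j * S2 $$ (j, k))" if "\<And>j. j < d2 \<Longrightarrow> j \<notin> C2 \<Longrightarrow> t j = 0" "k < n" for t k
    using sum_class_list[OF C2, of "\<lambda>j. t j * S2 $$ (j, k)"] that proj_mult_index[OF C2 S2]
    by (simp add: q2_def)
  have rows: "row U1 l \<in> carrier_vec q1" "row U2 l \<in> carrier_vec q2" if "l < q" for l
    using U1 U2 that by auto
  have lincomb: "lincomb (q1 + q2) c (map (\<lambda>i. row U1 i @\<^sub>v row U2 i) [0..<q]) =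
      vec q1 (\<lambda>i. \<Sum>l<q. c l * U1 $$ (l, i)) @\<^sub>v vec q2 (\<lambda>i. \<Sum>l<q. c l * U2 $$ (l, i))" for c
  proof (rule eq_vecI)
    fix i assume i: "i < dim_vec (vec q1 (\<lambda>i. \<Sum>l<q. c l * U1 $$ (l, i)) @\<^sub>v
      vec q2 (\<lambda>i. \<Sum>l<q. c l * U2 $$ (l, i)))"
    have "(row U1 l @\<^sub>v row U2 l) $ i = (if i < q1 then U1 $$ (l, i) else U2 $$ (l, i - q1))"
      if "l < q" for l using i rows[OF that] U1 U2 that by auto
    then show "lincomb (q1 + q2) c (map (\<lambda>i. row U1 i @\<^sub>v row U2 i) [0..<q]) $ i =
        (vec q1 (\<lambda>i. \<Sum>l<q. c l * U1 $$ (l, i)) @\<^sub>v vec q2 (\<lambda>i. \<Sum>l<q. c l * U2 $$ (l, i))) $ i"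
      using i by simp
  qed simp
  have eq: "P1 * S1 = P2 * S2"
  proof (rule eq_matI)
    fix l k assume "l < dim_row (P2 * S2)" "k < dim_col (P2 * S2)"
    then have lk: "l < q" "k < n" using P2 S2 by auto
    have "row U1 l @\<^sub>v row U2 l \<in> pushout_space (proj d1 C1 * S1) (proj d2 C2 * S2)"
      using basis lk(1) by (auto simp: is_basis_def)
    then have "(\<Sum>i<q1. row U1 l $ i * (proj d1 C1 * S1) $$ (i, k)) =
        (\<Sum>i<q2. row U2 l $ i * (proj d2 C2 * S2) $$ (i, k))"
      unfolding pushout_space_iff[OF A B rows[OF lk(1)]] using lk(2) by blast
    moreover have "(\<Sum>i<q1. row U1 l $ i * (proj d1 C1 * S1) $$ (i, k)) =
        (\<Sum>i<q1. P1 $$ (l, class_list C1 ! i) * (proj d1 C1 * S1) $$ (i, k))"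
      by (rule sum.cong) (use P1_index(1)[OF lk(1)] U1 lk(1) in auto)
    moreover have "(\<Sum>i<q2. row U2 l $ i * (proj d2 C2 * S2) $$ (i, k)) =
        (\<Sum>i<q2. P2 $$ (l, class_list C2 ! i) * (proj d2 C2 * S2) $$ (i, k))"
      by (rule sum.cong) (use P2_index(1)[OF lk(1)] U2 lk(1) in auto)
    ultimately show "(P1 * S1) $$ (l, k) = (P2 * S2) $$ (l, k)"
      unfolding mult_mat_index[OF P1 S1 lk] mult_mat_index[OF P2 S2 lk]
      using reindex1[of "\<lambda>j. P1 $$ (l, j)" k] reindex2[of "\<lambda>j. P2 $$ (l, j)" k]
        P1_index(2)[OF lk(1)] P2_index(2)[OF lk(1)] lk(2) by simp
  qed (use P1 P2 S1 S2 in auto)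
  have indep: "c l = 0"
    if z: "\<forall>j<d1. (\<Sum>l<q. c l * P1 $$ (l, j)) = 0" "\<forall>j<d2. (\<Sum>l<q. c l * P2 $$ (l, j)) = 0"
      and l: "l < q" for c l
  proof -
    have "(\<Sum>l<q. c l * U1 $$ (l, i)) = 0" if i: "i < q1" for i
    proof -
      have "class_list C1 ! i < d1" using class_list_nth[OF fin(1)] C1 i by (auto simp: q1_def)
      moreover have "(\<Sum>l<q. c l * U1 $$ (l, i)) = (\<Sum>l<q. c l * P1 $$ (l, class_list C1 ! i))"
        by (rule sum.cong) (use P1_index(1) i in auto)
      ultimately show ?thesis using z(1) by simp
    qed
    moreover have "(\<Sum>l<q. c l * U2 $$ (l, i)) = 0" if i: "i < q2" for i
    proof -
      have "class_list C2 ! i < d2" using class_list_nth[OF fin(2)] C2 i by (auto simp: q2_def)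
      moreover have "(\<Sum>l<q. c l * U2 $$ (l, i)) = (\<Sum>l<q. c l * P2 $$ (l, class_list C2 ! i))"
        by (rule sum.cong) (use P2_index(1) i in auto)
      ultimately show ?thesis using z(2) by simp
    qed
    ultimately have "lincomb (q1 + q2) c (map (\<lambda>i. row U1 i @\<^sub>v row U2 i) [0..<q]) = 0\<^sub>v (q1 + q2)"
      unfolding lincomb by (intro eq_vecI) auto
    with basis l show ?thesis unfolding is_basis_def by simp
  qed
  have span: "\<exists>c. (\<forall>j<d1. t1 j = (\<Sum>l<q. c l * P1 $$ (l, j))) \<and>
      (\<forall>j<d2. t2 j = (\<Sum>l<q. c l * P2 $$ (l, j)))"
    if t: "\<forall>j<d1. t1 j \<noteq> 0 \<longrightarrow> j \<in> C1" "\<forall>j<d2. t2 j \<noteq> 0 \<longrightarrow> j \<in> C2"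
      "\<forall>k<n. (\<Sum>j<d1. t1 j * S1 $$ (j, k)) = (\<Sum>j<d2. t2 j * S2 $$ (j, k))" for t1 t2
  proof -
    \<comment> \<open>Restricting \<open>t1\<close> and \<open>t2\<close> to their classes loses
      nothing, since both vanish elsewhere.\<close>
    let ?u1 = "vec q1 (\<lambda>i. t1 (class_list C1 ! i))" and ?u2 = "vec q2 (\<lambda>i. t2 (class_list C2 ! i))"
    have t1: "t1 j = 0" if "j < d1" "j \<notin> C1" for j using t(1) that by blast
    have t2: "t2 j = 0" if "j < d2" "j \<notin> C2" for j using t(2) that by blast
    have "?u1 @\<^sub>v ?u2 \<in> pushout_space (proj d1 C1 * S1) (proj d2 C2 * S2)"
      unfolding pushout_space_iff[OF A B vec_carrier vec_carrier]
    proof (intro allI impI)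
      fix k assume k: "k < n"
      show "(\<Sum>i<q1. ?u1 $ i * (proj d1 C1 * S1) $$ (i, k)) =
          (\<Sum>i<q2. ?u2 $ i * (proj d2 C2 * S2) $$ (i, k))"
        using reindex1[of t1 k] reindex2[of t2 k] t1 t2 t(3) k by simp
    qed
    with basis obtain c where
      "?u1 @\<^sub>v ?u2 = lincomb (q1 + q2) c (map (\<lambda>i. row U1 i @\<^sub>v row U2 i) [0..<q])"
      unfolding is_basis_def by blast
    then have c: "?u1 = vec q1 (\<lambda>i. \<Sum>l<q. c l * U1 $$ (l, i))"
      "?u2 = vec q2 (\<lambda>i. \<Sum>l<q. c l * U2 $$ (l, i))"
      unfolding lincomb by (simp_all add: append_vec_eq[of _ q1])
    have "t1 j = (\<Sum>l<q. c l * P1 $$ (l, j))" if j: "j < d1" for j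
    proof (cases "j \<in> C1")
      case True
      then obtain i where i: "i < q1" "j = class_list C1 ! i"
        using fin(1) by (metis in_set_conv_nth length_sorted_list_of_set q1_def set_sorted_list_of_set)
      have "t1 j = (\<Sum>l<q. c l * U1 $$ (l, i))"
        using arg_cong[OF c(1), of "\<lambda>v. v $ i"] i by simp
      also have "\<dots> = (\<Sum>l<q. c l * P1 $$ (l, j))"
        by (rule sum.cong) (use P1_index(1) i in auto)
      finally show ?thesis .
    next
      case False
      then show ?thesis using t1[OF j] P1_index(2)[OF _ j] by simp
    qed
    moreover have "t2 j = (\<Sum>l<q. c l * P2 $$ (l, j))" if j: "j < d2" for j
    proof (cases "j \<in> C2")
      case True
      then obtain i where i: "i < q2" "j = class_list C2 ! i"
        using fin(2) by (metis in_set_conv_nth length_sorted_list_of_set q2_def set_sorted_list_of_set)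
      have "t2 j = (\<Sum>l<q. c l * U2 $$ (l, i))"
        using arg_cong[OF c(2), of "\<lambda>v. v $ i"] i by simp
      also have "\<dots> = (\<Sum>l<q. c l * P2 $$ (l, j))"
        by (rule sum.cong) (use P2_index(1) i in auto)
      finally show ?thesis .
    next
      case False
      then show ?thesis using t2[OF j] P2_index(2)[OF _ j] by simp
    qed
    ultimately show ?thesis by blast
  qed
  have "block n d1 d2 S1 S2 C1 C2 q P1 P2"
    unfolding block_def
    using P1 P2 eq indep span P1_index(2) P2_index(2) by blast
  then show ?thesis using U1 by (simp add: U12 P1_def P2_def)
qed

section \<open>Stacking the blocks of all class pairs\<close>

text \<open>Addresses of the rows of a stack: entry \<open>i\<close> names the block and the row
  within it that become row \<open>i\<close>. Sums over stacked rows turn into sums over addresses,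
  which can be localised to one block.\<close>

definition stack_index :: "(nat \<Rightarrow> nat) \<Rightarrow> nat \<Rightarrow> (nat \<times> nat) list" where
  "stack_index q K = concat (map (\<lambda>k. map (Pair k) [0..<q k]) [0..<K])"

lemma set_stack_index: "set (stack_index q K) = {(k, l). k < K \<and> l < q k}"
  by (auto simp: stack_index_def)

lemma distinct_stack_index: "distinct (stack_index q K)"
proof (induction K)
  case (Suc K)
  have "stack_index q (Suc K) = stack_index q K @ map (Pair K) [0..<q K]" by (simp add: stack_index_def)
  with Suc show ?case by (auto simp: set_stack_index distinct_map inj_on_def)
qed (simp add: stack_index_def)

lemma stack_eq_rows:
  assumes "\<And>k. k < K \<Longrightarrow> dim_row (f k) = q k"
  shows "stack c (map f [0..<K]) = mat_of_rows c (map (\<lambda>(k, l). row (f k) l) (stack_index q K))"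
proof -
  have "map rows (map f [0..<K]) = map (\<lambda>k. map (\<lambda>(k, l). row (f k) l) (map (Pair k) [0..<q k])) [0..<K]"
    using assms by (auto simp: rows_def)
  then show ?thesis by (simp only: stack_def stack_index_def map_concat map_map o_def)
qed

lemma stack_carrier:
  assumes "\<And>k. k < K \<Longrightarrow> dim_row (f k) = q k"
  shows "stack c (map f [0..<K]) \<in> carrier_mat (length (stack_index q K)) c"
  using assms by (auto simp: stack_eq_rows[where q = q] intro!: carrier_matI)

lemma stack_nth:
  assumes "\<And>k. k < K \<Longrightarrow> f k \<in> carrier_mat (q k) c"
    and "i < length (stack_index q K)" "stack_index q K ! i = (k, l)" "j < c"
  shows "stack c (map f [0..<K]) $$ (i, j) = f k $$ (l, j)"
proof -
  have "(k, l) \<in> set (stack_index q K)" using nth_mem[OF assms(2)] assms(3) by simp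
  then have "k < K" "l < q k" by (auto simp: set_stack_index)
  then have "l < dim_row (f k)" "j < dim_col (f k)" using assms(1)[of k] assms(4) by auto
  moreover have "\<And>k. k < K \<Longrightarrow> dim_row (f k) = q k" using assms(1) by blast
  ultimately show ?thesis
    by (simp add: stack_eq_rows[where q = q] mat_of_rows_index assms(2-4))
qed

lemma sum_stack_index:
  fixes g :: "nat \<times> nat \<Rightarrow> rat"
  assumes "k < K" "\<And>k' l. k' < K \<Longrightarrow> l < q k' \<Longrightarrow> k' \<noteq> k \<Longrightarrow> g (k', l) = 0"
  shows "(\<Sum>i<length (stack_index q K). g (stack_index q K ! i)) = (\<Sum>l<q k. g (k, l))"
proof -
  have "(\<Sum>i<length (stack_index q K). g (stack_index q K ! i)) = (\<Sum>z\<in>set (stack_index q K). g z)"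
    by (rule sum.reindex_bij_betw, rule bij_betw_nth) (use distinct_stack_index in auto)
  also have "\<dots> = (\<Sum>z\<in>Pair k ` {..<q k}. g z)"
  proof (rule sum.mono_neutral_right)
    show "finite (set (stack_index q K))" by simp
  qed (use assms in \<open>auto simp: set_stack_index\<close>)
  also have "\<dots> = (\<Sum>l<q k. g (k, l))" by (subst sum.reindex) (auto simp: inj_on_def)
  finally show ?thesis .
qed

lemma blockD:
  assumes "block n d1 d2 S1 S2 C1 C2 q P1 P2"
  shows "P1 \<in> carrier_mat q d1" and "P2 \<in> carrier_mat q d2" and "P1 * S1 = P2 * S2"
    and "l < q \<Longrightarrow> j < d1 \<Longrightarrow> P1 $$ (l, j) \<noteq> 0 \<Longrightarrow> j \<in> C1"
    and "l < q \<Longrightarrow> j < d2 \<Longrightarrow> P2 $$ (l, j) \<noteq> 0 \<Longrightarrow> j \<in> C2"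
    and "(\<And>j. j < d1 \<Longrightarrow> (\<Sum>l<q. c l * P1 $$ (l, j)) = 0) \<Longrightarrow>
      (\<And>j. j < d2 \<Longrightarrow> (\<Sum>l<q. c l * P2 $$ (l, j)) = 0) \<Longrightarrow> l < q \<Longrightarrow> c l = 0"
    and "(\<And>j. j < d1 \<Longrightarrow> t1 j \<noteq> 0 \<Longrightarrow> j \<in> C1) \<Longrightarrow> (\<And>j. j < d2 \<Longrightarrow> t2 j \<noteq> 0 \<Longrightarrow> j \<in> C2) \<Longrightarrow>
      (\<And>k. k < n \<Longrightarrow> (\<Sum>j<d1. t1 j * S1 $$ (j, k)) = (\<Sum>j<d2. t2 j * S2 $$ (j, k))) \<Longrightarrow>
      \<exists>c. (\<forall>j<d1. t1 j = (\<Sum>l<q. c l * P1 $$ (l, j))) \<and>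
        (\<forall>j<d2. t2 j = (\<Sum>l<q. c l * P2 $$ (l, j)))"
  by (insert assms[unfolded block_def], elim conjE, assumption?; blast)+

text \<open>Since \<open>ps\<close> is distinct, a class pair determines its block. Coefficients
  confined to one class pair therefore live in one block, and independence and spanning of the stack
  reduce to those of that block.\<close>

lemma stack_blocks:
  assumes vasr: "is_vasr d1 V1" "is_vasr d2 V2" and norm: "normal S1 V1" "normal S2 V2"
    and S1: "S1 \<in> carrier_mat d1 n" and S2: "S2 \<in> carrier_mat d2 n"
    and ps: "distinct ps" "set ps = coherence_classes d1 V1 \<times> coherence_classes d2 V2"
    and block: "\<And>k. k < length ps \<Longrightarrow>
      block n d1 d2 S1 S2 (fst (ps ! k)) (snd (ps ! k)) (q k) (P1 k) (P2 k)"
  defines "T1 \<equiv> stack d1 (map P1 [0..<length ps])"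
    and "T2 \<equiv> stack d2 (map P2 [0..<length ps])"
  shows "join_data n d1 d2 (length (stack_index q (length ps))) S1 S2 T1 T2 V1 V2
      (\<lambda>i. fst (ps ! fst (stack_index q (length ps) ! i)))
      (\<lambda>i. snd (ps ! fst (stack_index q (length ps) ! i)))"
    and "stack n (map (\<lambda>k. P1 k * S1) [0..<length ps]) = T1 * S1"
proof -
  define K where "K = length ps"
  define ix where "ix = stack_index q K"
  define p where "p = length ix"
  note blocks = block[folded K_def]
  note P1 = blockD(1)[OF blocks] and P2 = blockD(2)[OF blocks] and P_eq = blockD(3)[OF blocks]
  have T1: "T1 \<in> carrier_mat p d1"
    unfolding T1_def p_def ix_def K_def[symmetric] by (rule stack_carrier, rule carrier_matD(1)[OF P1])
  have T2: "T2 \<in> carrier_mat p d2"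
    unfolding T2_def p_def ix_def K_def[symmetric] by (rule stack_carrier, rule carrier_matD(1)[OF P2])
  have T1_index: "T1 $$ (i, j) = P1 k $$ (l, j)" if "i < p" "ix ! i = (k, l)" "j < d1" for i j k l
    unfolding T1_def K_def[symmetric]
    by (rule stack_nth[OF P1 that[unfolded p_def ix_def]])
  have T2_index: "T2 $$ (i, j) = P2 k $$ (l, j)" if "i < p" "ix ! i = (k, l)" "j < d2" for i j k l
    unfolding T2_def K_def[symmetric]
    by (rule stack_nth[OF P2 that[unfolded p_def ix_def]])
  have ix: "fst (ix ! i) < K" "snd (ix ! i) < q (fst (ix ! i))" if "i < p" for i
    using nth_mem[of i ix] that set_stack_index[of q K] unfolding p_def ix_def by auto
  have TS_index: "(T1 * S1) $$ (i, c) = (P1 k * S1) $$ (l, c)" "(T2 * S2) $$ (i, c) = (P2 k * S2) $$ (l, c)"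
    if i: "i < p" "ix ! i = (k, l)" and c: "c < n" for i k l c
  proof -
    have kl: "k < K" "l < q k" using ix[OF i(1)] i(2) by auto
    show "(T1 * S1) $$ (i, c) = (P1 k * S1) $$ (l, c)"
      unfolding mult_mat_index[OF T1 S1 i(1) c] mult_mat_index[OF P1[OF kl(1)] S1 kl(2) c]
      by (rule sum.cong) (use T1_index[OF i] in auto)
    show "(T2 * S2) $$ (i, c) = (P2 k * S2) $$ (l, c)"
      unfolding mult_mat_index[OF T2 S2 i(1) c] mult_mat_index[OF P2[OF kl(1)] S2 kl(2) c]
      by (rule sum.cong) (use T2_index[OF i] in auto)
  qed
  have PS: "P1 k * S1 \<in> carrier_mat (q k) n" if "k < K" for k
    using P1[OF that] S1 by (rule mult_carrier_mat)
  have stack_PS: "stack n (map (\<lambda>k. P1 k * S1) [0..<K]) \<in> carrier_mat p n"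
    unfolding p_def ix_def by (rule stack_carrier, rule carrier_matD(1)[OF PS])
  show "stack n (map (\<lambda>k. P1 k * S1) [0..<length ps]) = T1 * S1"
    unfolding K_def[symmetric]
  proof (rule eq_matI)
    fix i c assume "i < dim_row (T1 * S1)" "c < dim_col (T1 * S1)"
    then have ic: "i < p" "c < n" using T1 S1 by auto
    obtain k l where kl: "ix ! i = (k, l)" by (cases "ix ! i")
    have "stack n (map (\<lambda>k. P1 k * S1) [0..<K]) $$ (i, c) = (P1 k * S1) $$ (l, c)"
      by (rule stack_nth[of K "\<lambda>k. P1 k * S1" q, OF PS ic(1)[unfolded p_def ix_def] kl[unfolded ix_def] ic(2)])
    then show "stack n (map (\<lambda>k. P1 k * S1) [0..<K]) $$ (i, c) = (T1 * S1) $$ (i, c)"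
      using TS_index(1)[OF ic(1) kl ic(2)] by simp
  qed (use stack_PS T1 S1 in auto)
  have block_sum1: "(\<Sum>i<p. g (ix ! i) * T1 $$ (i, j)) = (\<Sum>l<q k. g (k, l) * P1 k $$ (l, j))"
    if k: "k < K" and g: "\<And>k' l. k' < K \<Longrightarrow> l < q k' \<Longrightarrow> k' \<noteq> k \<Longrightarrow> g (k', l) = 0" and j: "j < d1" for g k j
  proof -
    have "(\<Sum>i<p. g (ix ! i) * T1 $$ (i, j)) =
        (\<Sum>i<p. (\<lambda>z. g z * P1 (fst z) $$ (snd z, j)) (ix ! i))"
      by (rule sum.cong) (use T1_index j in auto)
    also have "\<dots> = (\<Sum>l<q k. g (k, l) * P1 k $$ (l, j))"
      unfolding p_def ix_def by (subst sum_stack_index[OF k]) (use g in auto)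
    finally show ?thesis .
  qed
  have block_sum2: "(\<Sum>i<p. g (ix ! i) * T2 $$ (i, j)) = (\<Sum>l<q k. g (k, l) * P2 k $$ (l, j))"
    if k: "k < K" and g: "\<And>k' l. k' < K \<Longrightarrow> l < q k' \<Longrightarrow> k' \<noteq> k \<Longrightarrow> g (k', l) = 0" and j: "j < d2" for g k j
  proof -
    have "(\<Sum>i<p. g (ix ! i) * T2 $$ (i, j)) =
        (\<Sum>i<p. (\<lambda>z. g z * P2 (fst z) $$ (snd z, j)) (ix ! i))"
      by (rule sum.cong) (use T2_index j in auto)
    also have "\<dots> = (\<Sum>l<q k. g (k, l) * P2 k $$ (l, j))"
      unfolding p_def ix_def by (subst sum_stack_index[OF k]) (use g in auto)
    finally show ?thesis .
  qed
  show "join_data n d1 d2 (length (stack_index q (length ps))) S1 S2 T1 T2 V1 V2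
      (\<lambda>i. fst (ps ! fst (stack_index q (length ps) ! i)))
      (\<lambda>i. snd (ps ! fst (stack_index q (length ps) ! i)))"
    unfolding K_def[symmetric] ix_def[symmetric] p_def[symmetric]
  proof
    show "T1 * S1 = T2 * S2"
    proof (rule eq_matI)
      fix i c assume "i < dim_row (T2 * S2)" "c < dim_col (T2 * S2)"
      then have ic: "i < p" "c < n" using T2 S2 by auto
      obtain k l where kl: "ix ! i = (k, l)" by (cases "ix ! i")
      then have "k < K" using ix[OF ic(1)] by simp
      then show "(T1 * S1) $$ (i, c) = (T2 * S2) $$ (i, c)"
        unfolding TS_index(1)[OF ic(1) kl ic(2)] TS_index(2)[OF ic(1) kl ic(2)] by (simp add: P_eq)
    qed (use T1 T2 S1 S2 in auto)
    have ps_mem: "ps ! fst (ix ! i) \<in> coherence_classes d1 V1 \<times> coherence_classes d2 V2"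
      if "i < p" for i
      using nth_mem[of "fst (ix ! i)" ps] ix[OF that] ps(2) by (simp add: K_def)
    show "fst (ps ! fst (ix ! i)) \<in> coherence_classes d1 V1"
      "snd (ps ! fst (ix ! i)) \<in> coherence_classes d2 V2" if "i < p" for i
      using ps_mem[OF that] by (auto simp: mem_Times_iff)
    show "j \<in> fst (ps ! fst (ix ! i))" if "i < p" "j < d1" "T1 $$ (i, j) \<noteq> 0" for i j
      using that ix[OF that(1)] T1_index[OF that(1) prod.collapse[symmetric] that(2)] blockD(4)[OF blocks] by simp
    show "j \<in> snd (ps ! fst (ix ! i))" if "i < p" "j < d2" "T2 $$ (i, j) \<noteq> 0" for i j
      using that ix[OF that(1)] T2_index[OF that(1) prod.collapse[symmetric] that(2)] blockD(5)[OF blocks] by simp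
  next
    fix c :: "nat \<Rightarrow> rat" and C1 C2 i
    assume c: "\<And>i. i < p \<Longrightarrow> c i \<noteq> 0 \<Longrightarrow> fst (ps ! fst (ix ! i)) = C1 \<and> snd (ps ! fst (ix ! i)) = C2"
      and z1: "\<And>j. j < d1 \<Longrightarrow> (\<Sum>i<p. c i * T1 $$ (i, j)) = 0"
      and z2: "\<And>j. j < d2 \<Longrightarrow> (\<Sum>i<p. c i * T2 $$ (i, j)) = 0" and i: "i < p"
    \<comment> \<open>Carries the coefficients from row positions to addresses; the description
      operator inverts the enumeration \<open>ix\<close>, which has no repetitions.\<close>
    define g where "g z = (if z \<in> set ix then c (THE i. i < p \<and> ix ! i = z) else 0)" for z
    have dist: "distinct ix" unfolding ix_def by (rule distinct_stack_index)
    have g_ix: "g (ix ! i) = c i" if "i < p" for i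
    proof -
      have "(THE i'. i' < p \<and> ix ! i' = ix ! i) = i"
        by (rule the_equality) (use that dist nth_eq_iff_index_eq in \<open>auto simp: p_def\<close>)
      then show ?thesis using that by (simp add: g_def p_def)
    qed
    define k where "k = fst (ix ! i)"
    have kl: "k < K" "snd (ix ! i) < q k" using ix[OF i] by (simp_all add: k_def)
    show "c i = 0"
    proof (rule ccontr)
      assume ci: "c i \<noteq> 0"
      have g0: "g (k', l) = 0" if kl': "k' < K" "l < q k'" "k' \<noteq> k" for k' l
      proof (rule ccontr)
        assume ne: "g (k', l) \<noteq> 0"
        have "(k', l) \<in> set ix" using kl' by (simp add: ix_def set_stack_index)
        then obtain i' where i': "i' < p" "ix ! i' = (k', l)"
          unfolding p_def by (metis in_set_conv_nth)
        with ne g_ix[OF i'(1)] have "c i' \<noteq> 0" by simp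
        \<comment> \<open>A nonzero coefficient in another block would make two positions of
          \<open>ps\<close> hold the same class pair.\<close>
        with c[OF i'(1)] c[OF i ci] i'(2) have "ps ! k' = ps ! k"
          by (simp add: k_def prod_eq_iff)
        with ps(1) kl' kl(1) show False by (simp add: K_def nth_eq_iff_index_eq)
      qed
      have "(\<Sum>i<p. g (ix ! i) * T1 $$ (i, j)) = 0" if "j < d1" for j
        using z1[OF that] g_ix by simp
      then have s1: "(\<Sum>l<q k. g (k, l) * P1 k $$ (l, j)) = 0" if "j < d1" for j
        using block_sum1[where g = g, OF kl(1) g0 that] that by simp
      have "(\<Sum>i<p. g (ix ! i) * T2 $$ (i, j)) = 0" if "j < d2" for j
        using z2[OF that] g_ix by simp
      then have s2: "(\<Sum>l<q k. g (k, l) * P2 k $$ (l, j)) = 0" if "j < d2" for j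
        using block_sum2[where g = g, OF kl(1) g0 that] that by simp
      have "g (k, snd (ix ! i)) = 0"
        by (rule blockD(6)[OF blocks[OF kl(1)], of "\<lambda>l. g (k, l)", OF s1 s2 kl(2)])
      with g_ix[OF i] ci show False by (simp add: k_def)
    qed
  next
    fix C1 C2 and t1 t2 :: "nat \<Rightarrow> rat"
    assume C: "C1 \<in> coherence_classes d1 V1" "C2 \<in> coherence_classes d2 V2"
      and t: "\<And>j. j < d1 \<Longrightarrow> t1 j \<noteq> 0 \<Longrightarrow> j \<in> C1" "\<And>j. j < d2 \<Longrightarrow> t2 j \<noteq> 0 \<Longrightarrow> j \<in> C2"
        "\<And>k. k < n \<Longrightarrow> (\<Sum>j<d1. t1 j * S1 $$ (j, k)) = (\<Sum>j<d2. t2 j * S2 $$ (j, k))"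
    have "(C1, C2) \<in> set ps" using C ps(2) by simp
    then obtain k where k: "k < K" "ps ! k = (C1, C2)" unfolding K_def by (metis in_set_conv_nth)
    obtain c where c: "\<And>j. j < d1 \<Longrightarrow> t1 j = (\<Sum>l<q k. c l * P1 k $$ (l, j))"
      "\<And>j. j < d2 \<Longrightarrow> t2 j = (\<Sum>l<q k. c l * P2 k $$ (l, j))"
      using blockD(7)[OF blocks[OF k(1)], of t1 t2] t k(2) by auto
    \<comment> \<open>The coefficients found in block \<open>k\<close>, extended by zero to all
      other blocks.\<close>
    define g where "g z = (if fst z = k then c (snd z) else 0)" for z
    have g0: "g (k', l) = 0" if "k' < K" "l < q k'" "k' \<noteq> k" for k' l using that by (simp add: g_def)
    have "fst (ps ! fst (ix ! i)) = C1 \<and> snd (ps ! fst (ix ! i)) = C2" if "g (ix ! i) \<noteq> 0" for i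
      using that k(2) by (auto simp: g_def split: if_splits)
    moreover have "t1 j = (\<Sum>i<p. g (ix ! i) * T1 $$ (i, j))" if "j < d1" for j
      using block_sum1[where g = g, OF k(1) g0 that] c(1)[OF that] by (simp add: g_def)
    moreover have "t2 j = (\<Sum>i<p. g (ix ! i) * T2 $$ (i, j))" if "j < d2" for j
      using block_sum2[where g = g, OF k(1) g0 that] c(2)[OF that] by (simp add: g_def)
    ultimately show "\<exists>c. (\<forall>i<p. c i \<noteq> 0 \<longrightarrow> fst (ps ! fst (ix ! i)) = C1 \<and> snd (ps ! fst (ix ! i)) = C2) \<and>
        (\<forall>j<d1. t1 j = (\<Sum>i<p. c i * T1 $$ (i, j))) \<and> (\<forall>j<d2. t2 j = (\<Sum>i<p. c i * T2 $$ (i, j)))"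
      by (intro exI[of _ "\<lambda>i. g (ix ! i)"]) blast
  qed (fact vasr norm S1 S2 T1 T2)+
qed


lemma join_join_data:
  assumes join: "join n (S1, V1) (S2, V2) (S, V)"
    and S1: "S1 \<in> carrier_mat d1 n" and S2: "S2 \<in> carrier_mat d2 n"
    and vasr: "is_vasr d1 V1" "is_vasr d2 V2" and norm: "normal S1 V1" "normal S2 V2"
  obtains p T1 T2 cls1 cls2 where "join_data n d1 d2 p S1 S2 T1 T2 V1 V2 cls1 cls2"
    and "S = T1 * S1" and "V = image_vasr V1 T1 \<union> image_vasr V2 T2"
proof -
  have dims: "dim_row S1 = d1" "dim_row S2 = d2" using S1 S2 by auto
  from join obtain ps Us where ps: "distinct ps"
    "set ps = coherence_classes d1 V1 \<times> coherence_classes d2 V2" and len: "length Us = length ps"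
    and push: "\<And>k. k < length ps \<Longrightarrow>
      pushout (proj d1 (fst (ps ! k)) * S1) (proj d2 (snd (ps ! k)) * S2) (Us ! k)"
    and S: "S = stack n (map (\<lambda>k. fst (Us ! k) * proj d1 (fst (ps ! k)) * S1) [0..<length ps])"
    and V: "V = image_vasr V1 (stack d1 (map (\<lambda>k. fst (Us ! k) * proj d1 (fst (ps ! k))) [0..<length ps])) \<union>
      image_vasr V2 (stack d2 (map (\<lambda>k. snd (Us ! k) * proj d2 (snd (ps ! k))) [0..<length ps]))"
    unfolding join_def Let_def prod.case dims by blast
  have block: "block n d1 d2 S1 S2 (fst (ps ! k)) (snd (ps ! k)) (dim_row (fst (Us ! k)))
      (fst (Us ! k) * proj d1 (fst (ps ! k))) (snd (Us ! k) * proj d2 (snd (ps ! k)))"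
    if "k < length ps" for k
  proof (rule pushout_block[OF S1 S2 _ _ push[OF that]])
    have "ps ! k \<in> coherence_classes d1 V1 \<times> coherence_classes d2 V2"
      using nth_mem[OF that] ps(2) by simp
    then show "fst (ps ! k) \<subseteq> {..<d1}" "snd (ps ! k) \<subseteq> {..<d2}"
      using coherence_class_subset by (auto simp: mem_Times_iff)
  qed
  show thesis
    by (rule that, rule stack_blocks(1)[OF vasr norm S1 S2 ps block], assumption,
        rule trans[OF S stack_blocks(2)[OF vasr norm S1 S2 ps block]], assumption, rule V)
qed

lemma join_exists:
  assumes S1: "S1 \<in> carrier_mat d1 n" and S2: "S2 \<in> carrier_mat d2 n"
  shows "\<exists>A. join n (S1, V1) (S2, V2) A"
proof -
  have dims: "dim_row S1 = d1" "dim_row S2 = d2" using S1 S2 by auto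
  have "finite (coherence_classes d1 V1 \<times> coherence_classes d2 V2)"
    by (simp add: finite_coherence_classes)
  from finite_distinct_list[OF this] obtain ps where ps: "distinct ps"
    "set ps = coherence_classes d1 V1 \<times> coherence_classes d2 V2" by blast
  have "\<exists>U. pushout (proj d1 (fst c) * S1) (proj d2 (snd c) * S2) U" for c
    by (rule pushout_exists[OF mult_carrier_mat[OF proj_carrier S1] mult_carrier_mat[OF proj_carrier S2]])
  then obtain U where U: "\<And>c. pushout (proj d1 (fst c) * S1) (proj d2 (snd c) * S2) (U c)" by metis
  have "distinct ps \<and> set ps = coherence_classes d1 V1 \<times> coherence_classes d2 V2 \<and>
      length (map U ps) = length ps \<and> (\<forall>k<length ps.
        pushout (proj d1 (fst (ps ! k)) * S1) (proj d2 (snd (ps ! k)) * S2) (map U ps ! k))"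
    using ps U by simp
  then show ?thesis unfolding join_def Let_def prod.case dims by blast
qed

subsection \<open>Invariants of the algorithm\<close>

text \<open>A model of \<open>F\<close> is still in \<Gamma> or already covered. The last clause is
  the lower bound: even while \<open>V\<close> covers only some cubes, the current pair maps into
  every abstraction of \<open>F\<close>. It is stated with \<open>uniform_sim\<close>, the form that
  \<open>join_least\<close> consumes.\<close>

definition av_inv :: "nat \<Rightarrow> fm \<Rightarrow> av_state \<Rightarrow> bool" where
  "av_inv n F st \<longleftrightarrow> (case st of (S, V, G) \<Rightarrow>
    S \<in> carrier_mat (dim_row S) n \<and> is_vasr (dim_row S) V \<and> normal S V \<and>
    (\<forall>M. G M \<longrightarrow> int_ok (int_syms F) M \<and> qsem M (skolem F)) \<and>
    (\<forall>M. int_ok (int_syms F) M \<longrightarrow> qsem M (skolem F) \<longrightarrow>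
      G M \<or> gamma S V (pre_vec n M) (post_vec n M)) \<and>
    (is_lra F \<longrightarrow> (\<forall>S' V'. vasr_abstraction n F S' V' \<longrightarrow>
      (\<exists>T\<in>carrier_mat (dim_row S') (dim_row S). uniform_sim V T V' \<and> T * S = S'))))"

lemma av_inv_init: "av_inv n F (av_init n F)"
  unfolding av_inv_def av_init_def prod.case
proof (intro conjI allI impI)
  show "is_vasr (dim_row (1\<^sub>m n)) {}" by (simp add: is_vasr_def)
  fix S' V' assume "vasr_abstraction n F S' V'"
  then have S': "S' \<in> carrier_mat (dim_row S') n" by (simp add: vasr_abstraction_def)
  \<comment> \<open>With no transformers the simulation condition is vacuous, so \<open>S'\<close>
    itself is the factor through the identity.\<close>
  have "uniform_sim {} S' V'" by (simp add: uniform_sim_def)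
  moreover have "S' \<in> carrier_mat (dim_row S') (dim_row (1\<^sub>m n))" unfolding index_one_mat(2) by (rule S')
  ultimately show "\<exists>T\<in>carrier_mat (dim_row S') (dim_row (1\<^sub>m n)). uniform_sim {} T V' \<and> T * 1\<^sub>m n = S'"
    using right_mult_one_mat[OF S'] by blast
qed (auto intro: normal_one)

lemma abstraction_gamma:
  assumes "transition_formula n F" "vasr_abstraction n F S V"
    and "int_ok (int_syms F) M" "qsem M (skolem F)"
  shows "gamma S V (pre_vec n M) (post_vec n M)"
proof -
  have "tf_step n F (pre_vec n M) (post_vec n M)"
    using tf_step_skolem[OF assms(1)] assms(3,4) by blast
  with assms(2) have "vasr_step (dim_row S) V (S *\<^sub>v pre_vec n M) (S *\<^sub>v post_vec n M)"
    unfolding vasr_abstraction_def lin_sim_def by blast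
  then show ?thesis unfolding vasr_step_def gamma_def by blast
qed

lemma av_step_inv:
  assumes F: "transition_formula n F" and inv: "av_inv n F (S, V, G)"
    and step: "av_step n F (S, V, G) (S', V', G')"
  shows "av_inv n F (S', V', G')"
    and "\<exists>C\<in>set (dnf (skolem F)). (\<exists>M. G M \<and> cube_sem M C) \<and> \<not> (\<exists>M. G' M \<and> cube_sem M C)"
    and "G' M \<Longrightarrow> G M"
proof -
  define d1 where "d1 = dim_row S"
  from inv have S1: "S \<in> carrier_mat d1 n" and vasr1: "is_vasr d1 V" and norm1: "normal S V"
    and G_sem: "\<And>M. G M \<Longrightarrow> int_ok (int_syms F) M \<and> qsem M (skolem F)"
    and G_cov: "\<And>M. int_ok (int_syms F) M \<Longrightarrow> qsem M (skolem F) \<Longrightarrow>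
      G M \<or> gamma S V (pre_vec n M) (post_vec n M)"
    and best1: "\<And>S' V'. is_lra F \<Longrightarrow> vasr_abstraction n F S' V' \<Longrightarrow>
      \<exists>T\<in>carrier_mat (dim_row S') d1. uniform_sim V T V' \<and> T * S = S'"
    unfolding av_inv_def d1_def prod.case by blast+
  from step obtain M0 C A where M0: "G M0" "C \<in> set (dnf (skolem F))" "cube_sem M0 C"
    and A: "alpha_hat n (int_syms F) C A" and join_A: "join n (S, V) A (S', V')"
    and G': "G' = (\<lambda>M. G M \<and> \<not> gamma S' V' (pre_vec n M) (post_vec n M))"
    unfolding av_step_def prod.case by blast
  obtain Sc Vc where Ac: "A = (Sc, Vc)" by (cases A)
  have M0_int: "int_ok (int_syms F) M0" using G_sem[OF M0(1)] by blast
  from alpha_hatE[OF A[unfolded Ac] M0_int M0(3)] obtain d2 r a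
    where S2: "Sc \<in> carrier_mat d2 n" and Vc: "Vc = {(r, a)}" and vasr2: "is_vasr d2 Vc"
      and norm2: "normal Sc Vc"
      and cube: "\<And>M. int_ok (int_syms F) M \<Longrightarrow> cube_sem M C \<Longrightarrow>
        Sc *\<^sub>v post_vec n M = pmul r (Sc *\<^sub>v pre_vec n M) + a"
      and best2: "\<And>S' V' e r' a'. S' \<in> carrier_mat e n \<Longrightarrow> is_vasr e V' \<Longrightarrow> (r', a') \<in> V' \<Longrightarrow>
        (\<And>M. int_ok (int_syms F) M \<Longrightarrow> cube_sem M C \<Longrightarrow>
          S' *\<^sub>v post_vec n M = pmul r' (S' *\<^sub>v pre_vec n M) + a') \<Longrightarrow>
        \<exists>T\<in>carrier_mat e d2. uniform_sim Vc T V' \<and> T * Sc = S'" by metis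
  from join_join_data[OF join_A[unfolded Ac] S1 S2 vasr1 vasr2 norm1 norm2]
  obtain p T1 T2 cls1 cls2 where jd: "join_data n d1 d2 p S Sc T1 T2 V Vc cls1 cls2"
    and S': "S' = T1 * S" and V': "V' = image_vasr V T1 \<union> image_vasr Vc T2" by metis
  interpret j: join_data n d1 d2 p S Sc T1 T2 V Vc cls1 cls2 by (rule jd)
  interpret sw: join_data n d2 d1 p Sc S T2 T1 Vc V cls2 cls1 by (rule j.swap)
  have S'_carrier: "S' \<in> carrier_mat p n" unfolding S' using j.T1 S1 by simp
  then have dim: "dim_row S' = p" by simp
  have gamma1: "gamma S' V' (pre_vec n M) (post_vec n M)" if "gamma S V (pre_vec n M) (post_vec n M)" for M
    unfolding S' V'
    by (rule uniform_sim_gamma[OF j.image_sim j.T1 vasr1 S1 _ _ that]) simp_all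
  have gamma2: "gamma S' V' (pre_vec n M) (post_vec n M)" if "int_ok (int_syms F) M" "cube_sem M C" for M
  proof -
    have "gamma Sc Vc (pre_vec n M) (post_vec n M)" using cube[OF that] by (simp add: gamma_def Vc)
    then have "gamma (T2 * Sc) (image_vasr Vc T2 \<union> image_vasr V T1) (pre_vec n M) (post_vec n M)"
      by (rule uniform_sim_gamma[OF sw.image_sim j.T2 vasr2 S2 pre_post_carrier])
    then show ?thesis by (simp add: S' V' j.eq Un_commute)
  qed
  have best: "\<exists>T\<in>carrier_mat (dim_row R) p. uniform_sim V' T W \<and> T * S' = R"
    if lra: "is_lra F" and abs: "vasr_abstraction n F R W" for R W
  proof -
    have R: "R \<in> carrier_mat (dim_row R) n" and W: "is_vasr (dim_row R) W"
      using abs by (auto simp: vasr_abstraction_def)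
    have Z: "int_syms F = {}" by (rule int_syms_lra[OF lra])
    have int: "int_ok (int_syms F) M" for M by (simp add: Z int_ok_def)
    have cover: "gamma R W (pre_vec n M) (post_vec n M)" if "cube_sem M C" for M
      \<comment> \<open>A model of the cube \<open>C\<close> is a model of the Skolemized
        \<open>F\<close>, since \<open>C\<close> is one of its disjuncts.\<close>
      by (rule abstraction_gamma[OF F abs int]) (use that M0(2) qsem_dnf in blast)
    obtain r' a' where ra: "(r', a') \<in> W"
      "\<And>M. cube_sem M C \<Longrightarrow> R *\<^sub>v post_vec n M = pmul r' (R *\<^sub>v pre_vec n M) + a'"
      using cube_single_transformer[OF R W M0(3) cover] by metis
    obtain T2' where T2': "T2' \<in> carrier_mat (dim_row R) d2" "uniform_sim Vc T2' W" "T2' * Sc = R"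
      using best2[OF R W ra(1)] ra(2) by blast
    obtain T1' where T1': "T1' \<in> carrier_mat (dim_row R) d1" "uniform_sim V T1' W" "T1' * S = R"
      using best1[OF lra abs] by blast
    \<comment> \<open>Both products equal \<open>R\<close>, which is the compatibility premise of
      \<open>join_least\<close>.\<close>
    show ?thesis
      using j.join_least[OF T1'(1,2) T2'(1,2)] T1'(3) T2'(3) by (simp add: S' V')
  qed
  show "av_inv n F (S', V', G')"
    unfolding av_inv_def prod.case dim
  proof (intro conjI allI impI)
    show "S' \<in> carrier_mat p n" by (rule S'_carrier)
    show "is_vasr p V'"
      using j.image_is_vasr sw.image_is_vasr unfolding V' is_vasr_def by blast
    show "normal S' V'" unfolding S' V' by (rule j.join_normal)
    show "int_ok (int_syms F) M" "qsem M (skolem F)" if "G' M" for M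
      using that G_sem unfolding G' by blast+
    show "G' M \<or> gamma S' V' (pre_vec n M) (post_vec n M)"
      if "int_ok (int_syms F) M" "qsem M (skolem F)" for M
      using G_cov[OF that] gamma1 unfolding G' by blast
    show "\<exists>T\<in>carrier_mat (dim_row R) p. uniform_sim V' T W \<and> T * S' = R"
      if "is_lra F" "vasr_abstraction n F R W" for R W by (rule best[OF that])
  qed
  have "\<not> (\<exists>M. G' M \<and> cube_sem M C)"
    using gamma2 G_sem unfolding G' by blast
  then show "\<exists>C\<in>set (dnf (skolem F)). (\<exists>M. G M \<and> cube_sem M C) \<and> \<not> (\<exists>M. G' M \<and> cube_sem M C)"
    using M0 by blast
  show "G' M \<Longrightarrow> G M" unfolding G' by blast
qed

section \<open>Termination measure and correctness of all runs\<close>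

definition live_cubes :: "fm \<Rightarrow> av_state \<Rightarrow> atom list set" where
  "live_cubes F st = {C \<in> set (dnf (skolem F)). \<exists>M. snd (snd st) M \<and> cube_sem M C}"

lemma av_step_live_cubes:
  assumes "transition_formula n F" "av_inv n F st" "av_step n F st st'"
  shows "card (live_cubes F st') < card (live_cubes F st)"
proof -
  obtain S V G S' V' G' where st: "st = (S, V, G)" "st' = (S', V', G')" by (metis prod_cases3)
  note step = av_step_inv(2,3)[OF assms(1) assms(2)[unfolded st] assms(3)[unfolded st]]
  have "live_cubes F st' \<subset> live_cubes F st"
    using step unfolding live_cubes_def st snd_conv by blast
  then show ?thesis by (rule psubset_card_mono[rotated]) (simp add: live_cubes_def)
qed

lemma av_reachable_inv:
  assumes "transition_formula n F" "(av_step n F)\<^sup>*\<^sup>* (av_init n F) st"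
  shows "av_inv n F st"
  using assms(2)
proof induction
  case (step st st')
  then show ?case using av_step_inv(1)[OF assms(1)] by (metis prod_cases3)
qed (rule av_inv_init)

text \<open>The choice of model, cube, bases and enumeration is nondeterministic, so termination is
  expressed by the absence of infinite runs together with progress from every reachable state that
  is not final. The third conjunct then speaks about whatever result a run returns.\<close>

theorem theorem2:
  fixes n :: nat and F :: fm
  assumes "transition_formula n F"
  shows "\<not> (\<exists>f. f 0 = av_init n F \<and> (\<forall>k. av_step n F (f k) (f (Suc k)))) \<and>
    (\<forall>st. (av_step n F)\<^sup>*\<^sup>* (av_init n F) st \<longrightarrow> av_final st \<or> (\<exists>st'. av_step n F st st')) \<and>
    (\<forall>S V G. (av_step n F)\<^sup>*\<^sup>* (av_init n F) (S, V, G) \<longrightarrow> av_final (S, V, G) \<longrightarrow>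
           vasr_abstraction n F S V \<and> (is_lra F \<longrightarrow> best_abstraction n F S V))"
proof (intro conjI allI impI)
  show "\<not> (\<exists>f. f 0 = av_init n F \<and> (\<forall>k. av_step n F (f k) (f (Suc k))))"
  proof
    assume "\<exists>f. f 0 = av_init n F \<and> (\<forall>k. av_step n F (f k) (f (Suc k)))"
    then obtain f where f: "f 0 = av_init n F" "\<And>k. av_step n F (f k) (f (Suc k))" by blast
    have "(av_step n F)\<^sup>*\<^sup>* (av_init n F) (f k)" for k
    proof (induction k)
      case (Suc k)
      then show ?case using f(2)[of k] by (rule rtranclp.rtrancl_into_rtrancl)
    qed (simp add: f)
    then have dec: "card (live_cubes F (f (Suc k))) < card (live_cubes F (f k))" for k
      using av_step_live_cubes[OF assms av_reachable_inv[OF assms] f(2)] by blast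
    have "card (live_cubes F (f k)) + k \<le> card (live_cubes F (f 0))" for k
    proof (induction k)
      case (Suc k)
      then show ?case using dec[of k] by simp
    qed simp
    from this[of "Suc (card (live_cubes F (f 0)))"] show False by simp
  qed
next
  fix st assume reach: "(av_step n F)\<^sup>*\<^sup>* (av_init n F) st"
  obtain S V G where st: "st = (S, V, G)" by (metis prod_cases3)
  have inv: "av_inv n F (S, V, G)" using av_reachable_inv[OF assms reach] st by simp
  show "av_final st \<or> (\<exists>st'. av_step n F st st')"
  proof (cases "\<exists>M. G M")
    case True
    then obtain M where M: "G M" by blast
    with inv have "qsem M (skolem F)" unfolding av_inv_def prod.case by blast
    then obtain C where C: "C \<in> set (dnf (skolem F))" "cube_sem M C" by (auto simp: qsem_dnf)
    obtain Sc Vc where A: "alpha_hat n (int_syms F) C (Sc, Vc)"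
      using alpha_hat_exists by (metis surj_pair)
    then obtain d where Sc: "Sc \<in> carrier_mat d n" by (auto simp: alpha_hat_def)
    have "S \<in> carrier_mat (dim_row S) n" using inv unfolding av_inv_def prod.case by blast
    from join_exists[OF this Sc] obtain S' V' where "join n (S, V) (Sc, Vc) (S', V')"
      by (metis surj_pair)
    with M C A have "av_step n F st (S', V', \<lambda>M. G M \<and> \<not> gamma S' V' (pre_vec n M) (post_vec n M))"
      unfolding av_step_def st prod.case by blast
    then show ?thesis by blast
  qed (simp add: av_final_def st)
next
  fix S V G
  assume reach: "(av_step n F)\<^sup>*\<^sup>* (av_init n F) (S, V, G)" and final: "av_final (S, V, G)"
  have inv: "av_inv n F (S, V, G)" by (rule av_reachable_inv[OF assms reach])
  then have S: "S \<in> carrier_mat (dim_row S) n" and V: "is_vasr (dim_row S) V"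
    unfolding av_inv_def prod.case by blast+
  have "lin_sim (tf_step n F) S (vasr_step (dim_row S) V)"
    unfolding lin_sim_def
  proof (intro allI impI)
    fix u v assume "tf_step n F u v"
    then obtain M where M: "pre_vec n M = u" "post_vec n M = v" "int_ok (int_syms F) M" "qsem M (skolem F)"
      using tf_step_skolem[OF assms] by blast
    \<comment> \<open>In a final state \<Gamma> has no model left, so the coverage clause of the
      invariant leaves only \<open>gamma\<close>.\<close>
    have "gamma S V u v"
      using inv final M unfolding av_inv_def av_final_def prod.case by blast
    moreover have "S *\<^sub>v u \<in> carrier_vec (dim_row S)" "S *\<^sub>v v \<in> carrier_vec (dim_row S)"
      by (simp_all add: carrier_vecI)
    ultimately show "vasr_step (dim_row S) V (S *\<^sub>v u) (S *\<^sub>v v)"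
      unfolding gamma_def vasr_step_def by blast
  qed
  with S V show abs: "vasr_abstraction n F S V" unfolding vasr_abstraction_def by blast
  assume "is_lra F"
  show "best_abstraction n F S V"
    unfolding best_abstraction_def
  proof (intro conjI allI impI)
    fix S' V' assume "vasr_abstraction n F S' V'"
    with inv \<open>is_lra F\<close> obtain T where T: "T \<in> carrier_mat (dim_row S') (dim_row S)"
      "uniform_sim V T V'" "T * S = S'" unfolding av_inv_def prod.case by blast
    then show "abs_le (S, V) (S', V')"
      using uniform_sim_lin_sim[OF T(2,1) V] unfolding abs_le_def prod.case by blast
  qed (rule abs)
qed

end
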